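(* Let $(S)$ be a Hopf SDSE (with $F_i(0,\ldots,0)=1$ for all $i\in I$). The pre-Lie algebra $\mathfrak g_{(S)}=\mathrm{Prim}(\mathcal H_{(S)}^* )$ has a basis $(f_i(k))_{i\in I,k\ge1}$ (the one dual to $(X_i(k))_{i\in I,k\ge1}$), and the pre-Lie product of two elements of this basis is given by $$f_j(l)\star f_i(k)=\lambda_k^{(i,j)}f_i(k+l)\qquad(i,j\in I,\ k,l\ge1).$$
   Context: $K$ is a field of characteristic zero and $I$ a finite non-empty set. $\mathcal{H}_I$ is the (Connes-Kreimer) polynomial algebra generated by the set of (isomorphism classes of non-planar) rooted trees whose vertices are decorated by elements of $I$; monomials are forests; it is graded by the number of vertices, and $\widehat{\mathcal H_I}=\prod_n\mathcal H_I(n)$ is its completion. The coproduct is the algebra morphism with $\Delta(t)=t\otimes1+1\otimes t+\sum_cP^c(t)\otimes R^c(t)$ for each tree $t$, where $c$ runs over non-empty sets of edges of $t$ such that every path from the root to a leaf meets at most one edge of $c$; after deleting the edges of $c$, $R^c(t)$ is the component containing the root and $P^c(t)$ is the product of the other components. This makes $\mathcal H_I$ a Hopf algebra. $B_i^+$ is the linear (continuous) operator sending a forest to the tree obtained by grafting its trees on a common root decorated by $i$. The SDSE $(S)$ associated to non-constant series $(F_i)_{i\in I}$, $F_i\in K[[h_j,j\in I]]$, is the system $X_i=B_i^+(F_i(X_j,j\in I))$, $i\in I$; it has a unique solution $(X_i)_{i\in I}\in\widehat{\mathcal H_I}^{\,I}$. $X_i(n)$ is the homogeneous component of degree $n$ of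 $X_i$, and $\mathcal H_{(S)}$ is the subalgebra of $\mathcal H_I$ generated by all the $X_i(n)$. $(S)$ is Hopf if $\mathcal H_{(S)}$ is a Hopf subalgebra of $\mathcal H_I$. Write $X_i=\sum_ta_tt$, the sum over trees with root decorated by $i$, and let $\mathcal T_i(n)$ be the set of trees with $n$ vertices and root decorated by $i$. For a Hopf SDSE, for all $i,j\in I$, $n\ge1$, $\lambda_n^{(i,j)}$ is the (unique) scalar such that $\sum_{t\in\mathcal T_i(n+1)}n_j(t,t')a_t=\lambda_n^{(i,j)}a_{t'}$ for all $t'\in\mathcal T_i(n)$, where $n_j(t,t')$ is the number of leaves of $t$ decorated by $j$ whose removal gives $t'$. $\mathcal H_{(S)}^*$ is the graded dual of the graded connected commutative Hopf algebra $\mathcal H_{(S)}$, which is freely generated as a commutative algebra by the $X_i(k)$. $\mathrm{Prim}(\mathcal H_{(S)}^* )$ is the Lie algebra of its primitive elements (the elements vanishing on $1$ and on products of elements of the augmentation ideal); $f_i(k)$ is the element of it with $f_i(k)(X_j(l))=\delta_{i,j}\delta_{k,l}$. The pre-Lie product $\star$ on it is defined as follows: $f\star g$ is the unique element of $\mathfrak g_{(S)}$ such that $(f\star g)(x)=(f\otimes g)\circ(\pi\otimes\pi)\circ\Delta(x)$ for all $x\in\mathrm{Vect}(X_i(n): i\in I,n\ge1)$, where $\pi$ is the projection of $\mathcal H_I$ onto the span of trees which vanishes on the forests that are not trees. Pre-Lie means $(x\star y)\star z-x\star(y\star z)=(y\star x)\star z-y\star(x\star z)$. *)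

theory Defs
  imports
    "HOL-Library.Multiset"
    "HOL-Library.Poly_Mapping"
    "HOL-Library.Product_Plus"
    "HOL-Library.Function_Algebras"
    "HOL-Library.Sublist"
    "HOL-Computational_Algebra.Formal_Power_Series"
begin

text \<open>
  A value of the following type is an isomorphism class of (non-planar) decorated rooted trees;
  a forest is a multiset of trees, the empty forest \<open>0\<close> being the unit monomial.
\<close>

datatype 'i rtree = Node 'i "'i rtree multiset"

type_synonym 'i forest = "'i rtree multiset"

primrec root_deco :: "'i rtree \<Rightarrow> 'i" where
  "root_deco (Node i f) = i"

primrec nverts :: "'i rtree \<Rightarrow> nat" where
  "nverts (Node i f) = Suc (\<Sum>\<^sub># (image_mset nverts f))"

definition trees :: "'i \<Rightarrow> nat \<Rightarrow> 'i rtree set" where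
  "trees i n = {t. root_deco t = i \<and> nverts t = n}"

text \<open>
  Vertices and edges only make sense for a concrete tree, so cuts and leaf removals are
  performed on an arbitrary planar representative \<open>rep t\<close> of the class \<open>t\<close>. A vertex of a planar
  tree is named by its position (the list of child indices leading to it), and an edge by the
  position of its lower end, that is, by a non-root vertex.
\<close>

datatype 'i ptree = PNode (pdeco: 'i) (children: "'i ptree list")

primrec shape :: "'i ptree \<Rightarrow> 'i rtree" where
  "shape (PNode i ts) = Node i (mset (map shape ts))"

definition rep :: "'i rtree \<Rightarrow> 'i ptree" where
  "rep t = (SOME p. shape p = t)"

lemma ex_shape: "\<exists>p. shape p = t"
proof (induction t)
  case (Node i f)
  obtain ts where ts: "mset ts = f"
    using ex_mset by blast
  have "\<exists>p. shape p = s" if "s \<in> set ts" for s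
    using Node ts that by force
  then obtain g where g: "\<And>s. s \<in> set ts \<Longrightarrow> shape (g s) = s"
    by metis
  have "map (shape \<circ> g) ts = ts"
    using g by (auto intro: map_idI)
  then have "shape (PNode i (map g ts)) = Node i f"
    using ts by simp
  then show ?case ..
qed

lemma shape_rep [simp]: "shape (rep t) = t"
  unfolding rep_def by (rule someI_ex[OF ex_shape])

fun is_vertex :: "'i ptree \<Rightarrow> nat list \<Rightarrow> bool" where
  "is_vertex t [] = True"
| "is_vertex (PNode i ts) (k # p) = (k < length ts \<and> is_vertex (ts ! k) p)"

fun subtree :: "'i ptree \<Rightarrow> nat list \<Rightarrow> 'i ptree" where
  "subtree t [] = t"
| "subtree (PNode i ts) (k # p) = subtree (ts ! k) p"

definition edges :: "'i ptree \<Rightarrow> nat list set" where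
  "edges t = {p. is_vertex t p \<and> p \<noteq> []}"

definition leaves :: "'i ptree \<Rightarrow> nat list set" where
  "leaves t = {p. is_vertex t p \<and> children (subtree t p) = []}"

text \<open>\<open>prune c t\<close> is the component containing the root after deletion of the edges in \<open>c\<close>.\<close>

function prune :: "nat list set \<Rightarrow> 'i ptree \<Rightarrow> 'i ptree" where
  "prune c (PNode i ts) =
     PNode i (concat (map (\<lambda>k. if [k] \<in> c then [] else [prune {p. k # p \<in> c} (ts ! k)])
       [0..<length ts]))"
  by pat_completeness auto
termination
proof (relation "measure (\<lambda>(c, t). size t)", goal_cases)
  case 1
  then show ?case by simp
next
  case (2 c i ts k)
  then have "ts ! k \<in> set ts"
    by simp
  then have "size (ts ! k) < Suc (size_list size ts)"
    by (meson less_Suc_eq_le size_list_estimation' order_refl)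
  then show ?case by simp
qed

definition cuts :: "'i ptree \<Rightarrow> nat list set set" where
  "cuts t = {c. c \<noteq> {} \<and> c \<subseteq> edges t \<and> (\<forall>q \<in> leaves t. card {e \<in> c. prefix e q} \<le> 1)}"

definition R_cut :: "nat list set \<Rightarrow> 'i ptree \<Rightarrow> 'i rtree" where
  "R_cut c t = shape (prune c t)"

text \<open>Each deleted edge is the upper end of exactly one component not containing the root.\<close>

definition P_cut :: "nat list set \<Rightarrow> 'i ptree \<Rightarrow> 'i forest" where
  "P_cut c t = (\<Sum>e\<in>c. {# shape (prune {p. e @ p \<in> c} (subtree t e)) #})"

definition n_leaf :: "'i \<Rightarrow> 'i rtree \<Rightarrow> 'i rtree \<Rightarrow> nat" where
  "n_leaf j t t' = card {p \<in> leaves (rep t) \<inter> edges (rep t).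
     pdeco (subtree (rep t) p) = j \<and> shape (prune {p} (rep t)) = t'}"

text \<open>
  The algebra of decorated rooted trees is the monoid algebra of the monoid of forests, and its
  tensor square is the monoid algebra of the monoid of pairs of forests.
\<close>

type_synonym ('i, 'k) ck = "'i forest \<Rightarrow>\<^sub>0 'k"
type_synonym ('i, 'k) ck2 = "('i forest \<times> 'i forest) \<Rightarrow>\<^sub>0 'k"

definition scale :: "'k::field \<Rightarrow> ('b \<Rightarrow>\<^sub>0 'k) \<Rightarrow> ('b \<Rightarrow>\<^sub>0 'k)" where
  "scale c x = Poly_Mapping.map ((*) c) x"

lemma lookup_scale [simp]: "Poly_Mapping.lookup (scale c x) b = c * Poly_Mapping.lookup x b"
  by (simp add: scale_def Poly_Mapping.map.rep_eq when_def)

global_interpretation free: vector_space scale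
  by unfold_locales (auto intro!: poly_mapping_eqI simp: Poly_Mapping.lookup_add algebra_simps)

definition lin_ext :: "('b \<Rightarrow> ('c \<Rightarrow>\<^sub>0 'k::field)) \<Rightarrow> ('b \<Rightarrow>\<^sub>0 'k) \<Rightarrow> ('c \<Rightarrow>\<^sub>0 'k)" where
  "lin_ext g x = (\<Sum>b\<in>Poly_Mapping.keys x. scale (Poly_Mapping.lookup x b) (g b))"

definition basis_elt :: "'b \<Rightarrow> ('b \<Rightarrow>\<^sub>0 'k::field)" where
  "basis_elt b = Poly_Mapping.single b 1"

definition homog :: "nat \<Rightarrow> ('i, 'k::field) ck set" where
  "homog n = {x. \<forall>f\<in>Poly_Mapping.keys x. \<Sum>\<^sub># (image_mset nverts f) = n}"

definition tensor :: "('i, 'k::field) ck \<Rightarrow> ('i, 'k) ck \<Rightarrow> ('i, 'k) ck2" where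
  "tensor u v = lin_ext (\<lambda>f. lin_ext (\<lambda>g. basis_elt (f, g)) v) u"

definition tensor_set :: "('i, 'k::field) ck set \<Rightarrow> ('i, 'k) ck2 set" where
  "tensor_set A = free.span {tensor u v | u v. u \<in> A \<and> v \<in> A}"

definition tensor_map ::
    "(('i, 'k::field) ck \<Rightarrow> ('i, 'k) ck) \<Rightarrow> (('i, 'k) ck \<Rightarrow> ('i, 'k) ck) \<Rightarrow> ('i, 'k) ck2 \<Rightarrow> ('i, 'k) ck2"
  where
  "tensor_map \<phi> \<psi> = lin_ext (\<lambda>(f, g). tensor (\<phi> (basis_elt f)) (\<psi> (basis_elt g)))"

definition coprod_tree :: "'i rtree \<Rightarrow> ('i, 'k::field) ck2" where
  "coprod_tree t = basis_elt ({#t#}, 0) + basis_elt (0, {#t#})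
     + (\<Sum>c \<in> cuts (rep t). basis_elt (P_cut c (rep t), {# R_cut c (rep t) #}))"

definition coprod :: "('i, 'k::field) ck \<Rightarrow> ('i, 'k) ck2" where
  "coprod = lin_ext (\<lambda>f. \<Prod>\<^sub># (image_mset coprod_tree f))"

definition counit :: "('i, 'k::field) ck \<Rightarrow> 'k" where
  "counit x = Poly_Mapping.lookup x 0"

definition mult_map :: "('i, 'k::field) ck2 \<Rightarrow> ('i, 'k) ck" where
  "mult_map = lin_ext (\<lambda>(f, g). basis_elt (f + g))"

text \<open>The antipode is the two-sided convolution inverse of the identity, hence unique.\<close>

definition antipode :: "('i, 'k::field) ck \<Rightarrow> ('i, 'k) ck" where
  "antipode = (THE S. Vector_Spaces.linear scale scale S \<and>
     (\<forall>x. mult_map (tensor_map S id (coprod x)) = scale (counit x) 1 \<and>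
          mult_map (tensor_map id S (coprod x)) = scale (counit x) 1))"

definition subalgebra :: "('i, 'k::field) ck set \<Rightarrow> bool" where
  "subalgebra A \<longleftrightarrow> free.subspace A \<and> 1 \<in> A \<and> (\<forall>x\<in>A. \<forall>y\<in>A. x * y \<in> A)"

definition generated_subalgebra :: "('i, 'k::field) ck set \<Rightarrow> ('i, 'k) ck set" where
  "generated_subalgebra G = \<Inter> {A. subalgebra A \<and> G \<subseteq> A}"

definition hopf_subalgebra :: "('i, 'k::field) ck set \<Rightarrow> bool" where
  "hopf_subalgebra A \<longleftrightarrow> subalgebra A \<and> coprod ` A \<subseteq> tensor_set A \<and> antipode ` A \<subseteq> A"

definition tree_proj :: "('i, 'k::field) ck \<Rightarrow> ('i, 'k) ck" where
  "tree_proj = lin_ext (\<lambda>f. if size f = 1 then basis_elt f else 0)"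

text \<open>
  The completion, the product over \<open>n\<close> of the components \<open>homog n\<close>, is identified with the ring of
  power series in a bookkeeping variable whose \<open>n\<close>-th coefficient is homogeneous of degree \<open>n\<close>.
\<close>

definition completion :: "('i, 'k::field) ck fps set" where
  "completion = {x. \<forall>n. fps_nth x n \<in> homog n}"

definition graft :: "'i \<Rightarrow> ('i, 'k::field) ck \<Rightarrow> ('i, 'k) ck" where
  "graft i = lin_ext (\<lambda>f. basis_elt {# Node i f #})"

definition graft_hat :: "'i \<Rightarrow> ('i, 'k::field) ck fps \<Rightarrow> ('i, 'k) ck fps" where
  "graft_hat i x = Abs_fps (\<lambda>n. case n of 0 \<Rightarrow> 0 | Suc m \<Rightarrow> graft i (fps_nth x m))"

text \<open>
  A power series in the indeterminates \<open>h\<^sub>j\<close> is the family of its coefficients, indexed by exponent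
  vectors. When the \<open>X j\<close> have zero constant term, only finitely many exponent vectors contribute
  in a given degree.
\<close>

type_synonym ('i, 'k) mps = "('i \<Rightarrow> nat) \<Rightarrow> 'k"

definition eval_mps ::
    "('i::finite, 'k::field) mps \<Rightarrow> ('i \<Rightarrow> ('i, 'k) ck fps) \<Rightarrow> ('i, 'k) ck fps" where
  "eval_mps G X =
     Abs_fps (\<lambda>n. Sum_any (\<lambda>p. scale (G p) (fps_nth (\<Prod>j\<in>UNIV. X j ^ p j) n)))"

definition nonconstant :: "('i, 'k::field) mps \<Rightarrow> bool" where
  "nonconstant G \<longleftrightarrow> (\<exists>p. p \<noteq> (\<lambda>_. 0) \<and> G p \<noteq> 0)"

definition sdse_solution ::
    "('i::finite \<Rightarrow> ('i, 'k::field) mps) \<Rightarrow> ('i \<Rightarrow> ('i, 'k) ck fps) \<Rightarrow> bool" where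
  "sdse_solution F X \<longleftrightarrow>
     (\<forall>i. X i \<in> completion) \<and> (\<forall>i. X i = graft_hat i (eval_mps (F i) X))"

definition H_S :: "('i \<Rightarrow> ('i, 'k::field) ck fps) \<Rightarrow> ('i, 'k) ck set" where
  "H_S X = generated_subalgebra {fps_nth (X i) n | i n. True}"

definition tree_coeff :: "('i \<Rightarrow> ('i, 'k::field) ck fps) \<Rightarrow> 'i rtree \<Rightarrow> 'k" where
  "tree_coeff X t = Poly_Mapping.lookup (fps_nth (X (root_deco t)) (nverts t)) {#t#}"

definition sdse_lambda :: "('i \<Rightarrow> ('i, 'k::field) ck fps) \<Rightarrow> nat \<Rightarrow> 'i \<Rightarrow> 'i \<Rightarrow> 'k" where
  "sdse_lambda X n i j = (THE c. \<forall>t' \<in> trees i n.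
     (\<Sum>t \<in> trees i (Suc n). of_nat (n_leaf j t t') * tree_coeff X t) = c * tree_coeff X t')"

text \<open>
  A linear form on a subspace \<open>H\<close> is represented by the function extending it by \<open>0\<close> outside \<open>H\<close>.
\<close>

definition fscale :: "'k::field \<Rightarrow> ('a \<Rightarrow> 'k) \<Rightarrow> 'a \<Rightarrow> 'k" where
  "fscale c f = (\<lambda>x. c * f x)"

global_interpretation form: vector_space fscale
  by unfold_locales (auto simp: fscale_def fun_eq_iff algebra_simps)

definition graded_dual :: "('i, 'k::field) ck set \<Rightarrow> (('i, 'k) ck \<Rightarrow> 'k) set" where
  "graded_dual H = {f. (\<forall>x. x \<notin> H \<longrightarrow> f x = 0)
     \<and> (\<forall>x\<in>H. \<forall>y\<in>H. f (x + y) = f x + f y)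
     \<and> (\<forall>c. \<forall>x\<in>H. f (scale c x) = c * f x)
     \<and> (\<exists>N. \<forall>n\<ge>N. \<forall>x\<in>H \<inter> homog n. f x = 0)}"

text \<open>
  A form is primitive for the coproduct dual to the product of \<open>H\<close> exactly if it vanishes on \<open>1\<close>
  and on products of two elements of the augmentation ideal.
\<close>

definition prim_dual :: "('i, 'k::field) ck set \<Rightarrow> (('i, 'k) ck \<Rightarrow> 'k) set" where
  "prim_dual H = {f \<in> graded_dual H. f 1 = 0
     \<and> (\<forall>x\<in>H. \<forall>y\<in>H. counit x = 0 \<longrightarrow> counit y = 0 \<longrightarrow> f (x * y) = 0)}"

definition g_S :: "('i \<Rightarrow> ('i, 'k::field) ck fps) \<Rightarrow> (('i, 'k) ck \<Rightarrow> 'k) set" where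
  "g_S X = prim_dual (H_S X)"

definition dual_elt :: "('i \<Rightarrow> ('i, 'k::field) ck fps) \<Rightarrow> 'i \<Rightarrow> nat \<Rightarrow> ('i, 'k) ck \<Rightarrow> 'k" where
  "dual_elt X i k = (THE f. f \<in> g_S X \<and>
     (\<forall>j. \<forall>l\<ge>1. f (fps_nth (X j) l) = (if i = j \<and> k = l then 1 else 0)))"

text \<open>
  The value of \<open>f \<otimes> g\<close> on an element of \<open>H \<otimes> H\<close>, computed from any expression of that element as a
  sum of pure tensors of elements of \<open>H\<close>.
\<close>

definition tensor_form ::
    "('i, 'k::field) ck set \<Rightarrow> (('i, 'k) ck \<Rightarrow> 'k) \<Rightarrow> (('i, 'k) ck \<Rightarrow> 'k) \<Rightarrow> ('i, 'k) ck2 \<Rightarrow> 'k" where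
  "tensor_form H f g z = (THE c. \<exists>xs. (\<forall>(u, v)\<in>set xs. u \<in> H \<and> v \<in> H)
     \<and> z = (\<Sum>(u, v)\<leftarrow>xs. tensor u v) \<and> c = (\<Sum>(u, v)\<leftarrow>xs. f u * g v))"

definition prelie ::
    "('i \<Rightarrow> ('i, 'k::field) ck fps) \<Rightarrow> (('i, 'k) ck \<Rightarrow> 'k) \<Rightarrow> (('i, 'k) ck \<Rightarrow> 'k) \<Rightarrow> ('i, 'k) ck \<Rightarrow> 'k"
  where
  "prelie X f g = (THE h. h \<in> g_S X \<and>
     (\<forall>x \<in> free.span {fps_nth (X i) n | i n. n \<ge> 1}.
        h x = tensor_form (H_S X) f g (tensor_map tree_proj tree_proj (coprod x))))"

end

theory Submission
  imports Defs
begin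

text \<open>
  Let \<open>D\<^sub>s\<close> be the derivation of the algebra of trees that removes a branch equal to \<open>s\<close>. Both
  \<open>D\<^sub>s\<close> and \<open>a\<^sub>s D\<^sub>j\<close>, where \<open>j\<close> stands for the one-vertex tree with the root decoration of
  \<open>s\<close>, give solutions of the same linear system when applied to the \<open>X\<^sub>i\<close>, because the inhomogeneous
  part depends on \<open>s\<close> only through \<open>j\<close> and, linearly, \<open>a\<^sub>s\<close>. Hence the terms \<open>s \<otimes> r\<close> of
  \<open>\<Delta>(X\<^sub>i)\<close> are determined by those in which \<open>s\<close> is a single vertex, and these are given by
  \<open>\<lambda>\<close> since the Hopf property forces the coefficient of \<open>s \<otimes> r\<close> to be proportional to
  \<open>a\<^sub>s a\<^sub>r\<close>. As the \<open>F\<^sub>i\<close> are not constant, each \<open>X\<^sub>i(n)\<close> contains some tree with a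
  nonzero coefficient; reading off its coefficient gives the element of the dual basis.
\<close>

section \<open>Linear extensions\<close>

abbreviation lookup where "lookup \<equiv> Poly_Mapping.lookup"
abbreviation keys where "keys \<equiv> Poly_Mapping.keys"

lemma lookup_basis_elt: "lookup (basis_elt b) c = (if b = c then 1 else 0)"
  by (simp add: basis_elt_def lookup_single when_def)

lemma basis_elt_mult: "basis_elt f * basis_elt g = (basis_elt (f + g) :: 'b::monoid_add \<Rightarrow>\<^sub>0 'k::field)"
  by (simp add: basis_elt_def mult_single)

lemma basis_elt_zero: "basis_elt 0 = (1 :: 'b::monoid_add \<Rightarrow>\<^sub>0 'k::field)"
  by (simp add: basis_elt_def)

text \<open>Scalars become ring elements, so bilinearity of the product reduces to associativity and
  commutativity, and a scalar can be placed inside \<open>fps_const\<close>.\<close>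

lemma scale_eq_mult: "scale c x = (Poly_Mapping.single 0 c * x :: 'b::monoid_add \<Rightarrow>\<^sub>0 'k::field)"
proof -
  have "scale c x = (\<Sum>b\<in>keys x. Poly_Mapping.single b (c * lookup x b))"
    by (rule poly_mapping_eqI)
      (auto simp: lookup_sum lookup_single when_def in_keys_iff sum.delta)
  also have "\<dots> = Poly_Mapping.single 0 c * (\<Sum>b\<in>keys x. Poly_Mapping.single b (lookup x b))"
    by (simp add: sum_distrib_left mult_single)
  also have "(\<Sum>b\<in>keys x. Poly_Mapping.single b (lookup x b)) = x"
    by (rule poly_mapping_eqI)
      (auto simp: lookup_sum lookup_single when_def in_keys_iff sum.delta)
  finally show ?thesis .
qed

lemma scale_mult_left: "scale c x * y = (scale c (x * y) :: 'b::monoid_add \<Rightarrow>\<^sub>0 'k::field)"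
  by (simp add: scale_eq_mult mult.assoc)

lemma scale_mult_right:
  "x * scale c y = (scale c (x * y) :: 'b::comm_monoid_add \<Rightarrow>\<^sub>0 'k::field)"
  by (simp add: scale_eq_mult mult_ac)

lemma lin_ext_superset:
  assumes "finite A" "keys x \<subseteq> A"
  shows "lin_ext g x = (\<Sum>b\<in>A. scale (lookup x b) (g b))"
  unfolding lin_ext_def
  by (rule sum.mono_neutral_left) (use assms in \<open>auto simp: in_keys_iff\<close>)

lemma lin_ext_add: "lin_ext g (x + y) = lin_ext g x + lin_ext g y"
proof -
  let ?A = "keys x \<union> keys y"
  have "lin_ext g z = (\<Sum>b\<in>?A. scale (lookup z b) (g b))" if "z \<in> {x, y, x + y}" for z
    by (rule lin_ext_superset) (use that keys_add[of x y] in auto)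
  then show ?thesis
    by (simp add: lookup_add free.scale_left_distrib sum.distrib)
qed

lemma lin_ext_scale: "lin_ext g (scale c x) = scale c (lin_ext g x)"
proof -
  have "lin_ext g (scale c x) = (\<Sum>b\<in>keys x. scale (lookup (scale c x) b) (g b))"
    by (rule lin_ext_superset) (auto simp: in_keys_iff)
  then show ?thesis
    by (simp add: lin_ext_def free.scale_sum_right)
qed

lemma lin_ext_linear: "Vector_Spaces.linear scale scale (lin_ext g)"
  by unfold_locales (auto simp: lin_ext_add lin_ext_scale)

lemmas lin_ext_hom = lin_ext_linear[unfolded Vector_Spaces.linear_iff_module_hom]

lemmas lin_ext_zero [simp] = module_hom.zero[OF lin_ext_hom]
  and lin_ext_diff = module_hom.diff[OF lin_ext_hom]
  and lin_ext_sum = module_hom.sum[OF lin_ext_hom]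

lemma lin_ext_basis [simp]: "lin_ext g (basis_elt b) = g b"
  by (simp add: lin_ext_superset[of "{b}"] basis_elt_def)

lemma lookup_lin_ext: "lookup (lin_ext g x) c = (\<Sum>b\<in>keys x. lookup x b * lookup (g b) c)"
  by (simp add: lin_ext_def lookup_sum)

lemma lin_ext_basis_elt: "lin_ext basis_elt x = x"
  by (rule poly_mapping_eqI)
    (auto simp: lookup_lin_ext lookup_basis_elt in_keys_iff if_distrib sum.delta cong: if_cong)

lemma basis_induct:
  assumes "P 0" and "\<And>x y. P x \<Longrightarrow> P y \<Longrightarrow> P (x + y)" and "\<And>c x. P x \<Longrightarrow> P (scale c x)"
    and "\<And>b. P (basis_elt b)"
  shows "P x"
proof -
  have "P (\<Sum>b\<in>A. scale (lookup x b) (basis_elt b))" if "finite A" for A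
    using that by induction (auto intro: assms)
  then show ?thesis
    using lin_ext_basis_elt[of x] finite_keys[of x] unfolding lin_ext_def by metis
qed

section \<open>Tensors and the projection onto trees\<close>

lemma tensor_add_left: "tensor (u + u') v = tensor u v + tensor u' v"
  and tensor_scale_left: "tensor (scale c u) v = scale c (tensor u v)"
  by (auto simp: tensor_def lin_ext_add lin_ext_scale)

lemma lookup_tensor [simp]: "lookup (tensor u v) (f, g) = lookup u f * lookup v g"
proof -
  have "lookup (lin_ext (\<lambda>g'. basis_elt (f', g')) v) (f, g) = (if f' = f then lookup v g else 0)" for f'
    by (auto simp: lookup_lin_ext lookup_basis_elt in_keys_iff if_distrib sum.delta cong: if_cong)
  note this [simp]
  show ?thesis
    by (auto simp: tensor_def lookup_lin_ext[where x = u] in_keys_iff if_distrib sum.delta cong: if_cong)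
qed

lemma tensor_basis_elt: "tensor (basis_elt f) (basis_elt g) = basis_elt (f, g)"
  by (simp add: tensor_def)

lemma tensor_add_right: "tensor u (v + v') = tensor u v + tensor u v'"
  and tensor_scale_right: "tensor u (scale c v) = scale c (tensor u v)"
  by (auto intro!: poly_mapping_eqI simp: lookup_add algebra_simps)

lemma tensor_zero [simp]: "tensor 0 v = 0" "tensor u 0 = 0"
  by (auto intro!: poly_mapping_eqI)

lemma tensor_map_linear: "Vector_Spaces.linear scale scale (tensor_map \<phi> \<psi>)"
  unfolding tensor_map_def by (rule lin_ext_linear)

lemma tensor_map_tensor:
  assumes "Vector_Spaces.linear scale scale \<phi>" "Vector_Spaces.linear scale scale \<psi>"
  shows "tensor_map \<phi> \<psi> (tensor u v) = tensor (\<phi> u) (\<psi> v)"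
proof -
  interpret \<phi>: Vector_Spaces.linear scale scale \<phi> by fact
  interpret \<psi>: Vector_Spaces.linear scale scale \<psi> by fact
  have "tensor_map \<phi> \<psi> (tensor (basis_elt f) v) = tensor (\<phi> (basis_elt f)) (\<psi> v)" for f
  proof (induction v rule: basis_induct)
    case (4 b)
    show ?case by (simp add: tensor_basis_elt) (simp add: tensor_map_def)
  qed (simp_all add: tensor_add_right tensor_scale_right \<psi>.add \<psi>.scale tensor_map_def lin_ext_add
      lin_ext_scale)
  then show ?thesis
    by (induction u rule: basis_induct)
      (simp_all add: tensor_add_left tensor_scale_left \<phi>.add \<phi>.scale tensor_map_def lin_ext_add
      lin_ext_scale)
qed

lemma tree_proj_linear: "Vector_Spaces.linear scale scale tree_proj"
  unfolding tree_proj_def by (rule lin_ext_linear)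

lemma lookup_tree_proj: "lookup (tree_proj x) f = (if size f = 1 then lookup x f else 0)"
proof (induction x rule: basis_induct)
  case (4 b)
  then show ?case by (auto simp: tree_proj_def lookup_basis_elt)
qed (simp_all add: tree_proj_def lin_ext_add lin_ext_scale lookup_add)

text \<open>Only coefficients at pairs of trees are read off for the pre-Lie product, and there the
  projection changes nothing.\<close>

lemma lookup_tensor_map_tree_proj:
  "lookup (tensor_map tree_proj tree_proj z) (f, g) =
     (if size f = 1 \<and> size g = 1 then lookup z (f, g) else 0)"
proof (induction z rule: basis_induct)
  case (4 b)
  obtain f' g' where b: "b = (f', g')" by (cases b)
  show ?case
    unfolding b tensor_basis_elt[symmetric] tensor_map_tensor[OF tree_proj_linear tree_proj_linear]
    by (auto simp: lookup_tree_proj)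
qed (simp_all add: tensor_map_def lin_ext_add lin_ext_scale lookup_add)

lemma lookup_zero_mult: "lookup (x * y :: ('i, 'k::field) ck) 0 = lookup x 0 * lookup y 0"
proof (induction x rule: basis_induct)
  case (4 f)
  show ?case
  proof (induction y rule: basis_induct)
    case (4 g)
    then show ?case
      by (auto simp: basis_elt_mult lookup_basis_elt)
  qed (simp_all add: lookup_add distrib_left scale_mult_right mult.left_commute)
qed (simp_all add: lookup_add distrib_right scale_mult_left)

text \<open>A one-element multiset is a sum of two multisets only if one of them is empty. So the
  coefficient of a tree is an infinitesimal character: it kills products of elements of the
  augmentation ideal.\<close>

lemma lookup_single_mset_mult:
  "lookup (x * y :: ('i, 'k::field) ck) {#t#} =
     lookup x 0 * lookup y {#t#} + lookup x {#t#} * lookup y 0"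
proof (induction x rule: basis_induct)
  case (4 f)
  show ?case
  proof (induction y rule: basis_induct)
    case (4 g)
    then show ?case
      by (auto simp: basis_elt_mult lookup_basis_elt union_is_single)
  qed (simp_all add: lookup_add distrib_left scale_mult_right mult.left_commute)
qed (simp_all add: lookup_add distrib_right distrib_left scale_mult_left mult.assoc)

section \<open>Removal of a branch\<close>

lemma graft_basis_elt: "graft i (basis_elt f) = basis_elt {#Node i f#}"
  by (simp add: graft_def)

lemma graft_add: "graft i (x + y) = graft i x + graft i y"
  and graft_diff: "graft i (x - y) = graft i x - graft i y"
  and graft_scale: "graft i (scale c x) = scale c (graft i x)"
  and graft_zero [simp]: "graft i 0 = 0"
  and graft_sum: "graft i (sum h A) = (\<Sum>a\<in>A. graft i (h a))"
  by (simp_all add: graft_def lin_ext_add lin_ext_diff lin_ext_scale lin_ext_sum)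

lemma lookup_graft: "lookup (graft i x) {#Node i' f#} = (if i' = i then lookup x f else 0)"
proof (induction x rule: basis_induct)
  case (4 b)
  then show ?case by (auto simp: graft_basis_elt lookup_basis_elt)
qed (simp_all add: graft_add graft_scale lookup_add)

lemma lookup_graft_nonzero:
  assumes "lookup (graft i x) f \<noteq> 0"
  shows "\<exists>g. f = {#Node i g#} \<and> lookup x g \<noteq> 0"
proof (rule ccontr)
  assume *: "\<nexists>g. f = {#Node i g#} \<and> lookup x g \<noteq> 0"
  have "lookup (graft i x) f = (\<Sum>g\<in>keys x. lookup x g * (if {#Node i g#} = f then 1 else 0))"
    by (simp add: graft_def lookup_lin_ext lookup_basis_elt)
  also have "\<dots> = 0"
    by (rule sum.neutral) (use * in auto)
  finally show False
    using assms by simp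
qed

lemma nverts_less: "t \<in># f \<Longrightarrow> nverts t < nverts (Node i f)"
  by (induction f) auto

lemma nverts_pos: "nverts t > 0"
  by (cases t) simp

text \<open>
  \<open>cut_branch s t\<close> is the sum of what remains of \<open>t\<close> over all edges whose upper part is \<open>s\<close>;
  \<open>branch_deriv s\<close> is \<open>(Z\<^sub>s \<otimes> id) \<circ> \<Delta>\<close>, where the infinitesimal character \<open>Z\<^sub>s\<close> takes
  the coefficient of \<open>s\<close>. The latter is a derivation, and grafting intertwines both operators.
\<close>

function cut_branch :: "'i rtree \<Rightarrow> 'i rtree \<Rightarrow> ('i, 'k::field) ck" where
  "cut_branch s (Node i f) = graft i (\<Sum>t\<in>#f. basis_elt (f - {#t#}) *
     (cut_branch s t + (if t = s then 1 else 0)))"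
  by pat_completeness auto
termination
  by (relation "measure (nverts \<circ> snd)") (auto intro: nverts_less[simplified])

definition branch_deriv :: "'i rtree \<Rightarrow> ('i, 'k::field) ck \<Rightarrow> ('i, 'k) ck" where
  "branch_deriv s = lin_ext (\<lambda>f. \<Sum>t\<in>#f. basis_elt (f - {#t#}) *
     (cut_branch s t + (if t = s then 1 else 0)))"

lemma branch_deriv_add: "branch_deriv s (x + y) = branch_deriv s x + branch_deriv s y"
  and branch_deriv_scale: "branch_deriv s (scale c x) = scale c (branch_deriv s x)"
  and branch_deriv_zero [simp]: "branch_deriv s 0 = 0"
  and branch_deriv_sum: "branch_deriv s (sum h A) = (\<Sum>a\<in>A. branch_deriv s (h a))"
  by (simp_all add: branch_deriv_def lin_ext_add lin_ext_scale lin_ext_sum)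

lemma branch_deriv_basis: "branch_deriv s (basis_elt f) = (\<Sum>t\<in>#f. basis_elt (f - {#t#}) *
     (cut_branch s t + (if t = s then 1 else 0)))"
  by (simp add: branch_deriv_def)

lemma branch_deriv_tree:
  "branch_deriv s (basis_elt {#t#}) = cut_branch s t + (if t = s then 1 else 0)"
  by (simp add: branch_deriv_basis basis_elt_zero)

lemma lookup_branch_deriv_tree:
  "lookup (branch_deriv s (basis_elt {#t#})) {#r#} = lookup (cut_branch s t) {#r#}"
  by (simp add: branch_deriv_tree lookup_add lookup_one when_def)

lemma degree_cut_branch:
  "lookup (cut_branch s t :: ('i, 'k::field) ck) f \<noteq> 0 \<Longrightarrow> \<Sum>\<^sub># (image_mset nverts f) + nverts s = nverts t"
proof (induction t arbitrary: f)
  case (Node i g)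
  \<comment> \<open>These are the elements homogeneous of degree \<open>d - nverts s\<close>. The
    additive form avoids truncated subtraction and puts the constant \<open>1\<close> of the case
    \<open>t = s\<close> into \<open>hom (nverts t)\<close>.\<close>
  define hom :: "nat \<Rightarrow> ('i, 'k) ck set" where
    "hom d = {x. \<forall>f. lookup x f \<noteq> 0 \<longrightarrow> \<Sum>\<^sub># (image_mset nverts f) + nverts s = d}" for d
  have zero: "0 \<in> hom d" for d
    by (simp add: hom_def)
  have add: "x + y \<in> hom d" if "x \<in> hom d" "y \<in> hom d" for x y d
    unfolding hom_def
  proof (intro CollectI allI impI)
    fix f assume "lookup (x + y) f \<noteq> 0"
    then have "lookup x f \<noteq> 0 \<or> lookup y f \<noteq> 0"
      by (auto simp: lookup_add)
    with that show "\<Sum>\<^sub># (image_mset nverts f) + nverts s = d"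
      by (auto simp: hom_def)
  qed
  have summand: "basis_elt (g - {#t#}) * (cut_branch s t + (if t = s then 1 else 0)) \<in> hom (\<Sum>\<^sub># (image_mset nverts g))"
    if "t \<in># g" for t
  proof -
    let ?x = "cut_branch s t + (if t = s then 1 else 0) :: ('i, 'k) ck"
    have x: "?x \<in> hom (nverts t)"
      using Node.IH[OF that] by (intro add) (auto simp: hom_def lookup_one when_def)
    have deg: "(\<Sum>\<^sub># (image_mset nverts g)) = nverts t + \<Sum>\<^sub># (image_mset nverts (g - {#t#}))"
      using that by (metis add_mset_add_single image_mset_add_mset insert_DiffM sum_mset.insert)
    show ?thesis
      unfolding hom_def
    proof (intro CollectI allI impI)
      fix f assume "lookup (basis_elt (g - {#t#}) * ?x) f \<noteq> 0"
      then have "f \<in> keys (basis_elt (g - {#t#}) * ?x)"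
        by (simp add: in_keys_iff)
      then obtain f' where "f = g - {#t#} + f'" "f' \<in> keys ?x"
        using keys_mult[of "basis_elt (g - {#t#})" ?x] by (auto simp: basis_elt_def)
      with x deg show "\<Sum>\<^sub># (image_mset nverts f) + nverts s = \<Sum>\<^sub># (image_mset nverts g)"
        by (auto simp: hom_def in_keys_iff)
    qed
  qed
  have hom_sum: "(\<Sum>t\<in>#g'. h t) \<in> hom d" if "\<And>t. t \<in># g' \<Longrightarrow> h t \<in> hom d" for g' h d
    using that by (induction g') (auto intro: zero add)
  define y :: "('i, 'k) ck" where
    "y = (\<Sum>t\<in>#g. basis_elt (g - {#t#}) * (cut_branch s t + (if t = s then 1 else 0)))"
  have "y \<in> hom (\<Sum>\<^sub># (image_mset nverts g))"
    unfolding y_def by (rule hom_sum) (rule summand)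
  moreover have "lookup (graft i y) f \<noteq> 0"
    using Node.prems by (simp add: y_def)
  from lookup_graft_nonzero[OF this] obtain f' where "f = {#Node i f'#}" "lookup y f' \<noteq> 0"
    by auto
  ultimately show ?case
    by (auto simp: hom_def)
qed

text \<open>A tree removed from \<open>f + g\<close> is taken either from \<open>f\<close> or from
  \<open>g\<close>, and the other forest remains as a factor.\<close>

lemma branch_deriv_mult:
  "branch_deriv s (x * y) = branch_deriv s x * y + x * branch_deriv s y"
proof (induction x rule: basis_induct)
  case (4 f)
  show ?case
  proof (induction y rule: basis_induct)
    case (4 g)
    let ?h = "\<lambda>t. cut_branch s t + (if t = s then 1 else 0) :: ('a, 'b) ck"
    have "(\<Sum>t\<in>#f. basis_elt (f + g - {#t#}) * ?h t)
        = (\<Sum>t\<in>#f. (basis_elt (f - {#t#}) * ?h t) * basis_elt g)"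
    proof (intro arg_cong[where f = sum_mset] image_mset_cong)
      fix t assume "t \<in># f"
      then have "basis_elt (f + g - {#t#}) = basis_elt (f - {#t#}) * (basis_elt g :: ('a, 'b) ck)"
        by (simp add: basis_elt_mult)
      then show "basis_elt (f + g - {#t#}) * ?h t = basis_elt (f - {#t#}) * ?h t * basis_elt g"
        by (simp only: mult_ac)
    qed
    moreover have "(\<Sum>t\<in>#g. basis_elt (f + g - {#t#}) * ?h t)
        = (\<Sum>t\<in>#g. basis_elt f * (basis_elt (g - {#t#}) * ?h t))"
      by (intro arg_cong[where f = sum_mset] image_mset_cong)
        (simp add: basis_elt_mult flip: mult.assoc)
    ultimately show ?case
      by (simp add: branch_deriv_basis basis_elt_mult sum_mset_distrib_left sum_mset_distrib_right)
  qed (simp_all add: branch_deriv_add branch_deriv_scale scale_mult_left scale_mult_right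
      free.scale_right_distrib distrib_left add_ac)
qed (simp_all add: branch_deriv_add branch_deriv_scale scale_mult_left
      free.scale_right_distrib distrib_right add_ac)

text \<open>This is the cocycle identity for grafting, with the left tensor factor paired with
  \<open>s\<close>: a cut acts on the grafted forest, or it is the total cut, which leaves a
  constant exactly if the whole tree is \<open>s\<close>.\<close>

lemma branch_deriv_graft:
  "branch_deriv s (graft i x) =
     graft i (branch_deriv s x) + Poly_Mapping.single 0 (lookup (graft i x) {#s#})"
proof (induction x rule: basis_induct)
  case (3 c x)
  have "Poly_Mapping.single 0 (c * d) = scale c (Poly_Mapping.single (0 :: 'a forest) (d :: 'b))" for d
    by (simp add: scale_eq_mult mult_single)
  with 3 show ?case
    by (simp add: branch_deriv_scale graft_scale free.scale_right_distrib)
next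
  case (4 f)
  then show ?case
    by (simp add: graft_basis_elt branch_deriv_tree lookup_basis_elt flip: branch_deriv_basis)
qed (simp_all add: branch_deriv_add graft_add lookup_add single_add)

section \<open>Cutting one edge of a planar representative\<close>

lemma mset_concat_upt: "mset (concat (map g [0..<n])) = (\<Sum>k<n. mset (g k))"
  by (induction n) auto

lemma shape_prune: "shape (prune c (PNode i ts)) =
   Node i (\<Sum>k<length ts. if [k] \<in> c then {#} else {#shape (prune {p. k # p \<in> c} (ts ! k))#})"
proof -
  have "(\<Sum>k<length ts. mset (map shape (if [k] \<in> c then [] else [prune {p. k # p \<in> c} (ts ! k)])))
      = (\<Sum>k<length ts. if [k] \<in> c then {#} else {#shape (prune {p. k # p \<in> c} (ts ! k))#})"
    by (rule sum.cong) auto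
  then show ?thesis
    by (simp add: map_concat o_def mset_concat_upt)
qed

text \<open>The empty position is allowed in \<open>c\<close> because the part above a deleted edge
  \<open>e\<close> is pruned with the residual set \<open>{[]}\<close>; \<open>prune\<close> only
  tests positions of non-root vertices.\<close>

lemma prune_trivial: "\<forall>q\<in>c. q = [] \<Longrightarrow> prune c p = p"
proof (induction c p rule: prune.induct)
  case (1 c i ts)
  have "[k] \<notin> c" for k
    using 1 by auto
  moreover have "prune {p. k # p \<in> c} (ts ! k) = ts ! k" if "k < length ts" for k
    using 1 that by auto
  ultimately have "map (\<lambda>k. if [k] \<in> c then [] else [prune {p. k # p \<in> c} (ts ! k)])
       [0..<length ts] = map (\<lambda>k. [ts ! k]) [0..<length ts]"
    by simp
  then have "prune c (PNode i ts) = PNode i (concat (map (\<lambda>k. [ts ! k]) [0..<length ts]))"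
    by (simp only: prune.simps)
  also have "concat (map (\<lambda>k. [ts ! k]) [0..<length ts]) = map (\<lambda>k. ts ! k) [0..<length ts]"
    by (rule concat_map_singleton)
  finally show ?case
    by (simp add: map_nth)
qed

lemma edges_PNode:
  "edges (PNode i ts) = (\<Union>k<length ts. (#) k ` insert [] (edges (ts ! k)))" (is "?L = ?R")
proof (intro set_eqI iffI)
  fix q assume "q \<in> ?L"
  then show "q \<in> ?R"
    by (cases q) (auto simp: edges_def)
qed (auto simp: edges_def)

lemma finite_edges: "finite (edges p)"
  by (induction p) (simp add: edges_PNode)

lemma mset_map_shape: "mset (map shape ts) = (\<Sum>k<length ts. {#shape (ts ! k)#})"
proof -
  have "map shape ts = concat (map (\<lambda>k. [shape (ts ! k)]) [0..<length ts])"
    unfolding concat_map_singleton by (rule nth_equalityI) auto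
  then show ?thesis
    by (simp add: mset_concat_upt del: concat_map_singleton)
qed

lemma mset_map_shape_remove:
  assumes "k < length ts"
  shows "(\<Sum>l\<in>{..<length ts} - {k}. {#shape (ts ! l)#}) = mset (map shape ts) - {#shape (ts ! k)#}"
  unfolding mset_map_shape by (subst (2) sum.remove[of _ k]) (use assms in auto)

lemma shape_prune_child:
  assumes "k < length ts"
  shows "shape (prune {[k]} (PNode i ts)) = Node i (mset (map shape ts) - {#shape (ts ! k)#})"
proof -
  have "shape (prune {[k]} (PNode i ts)) = Node i (\<Sum>l\<in>{..<length ts} - {k}. {#shape (ts ! l)#})"
    unfolding shape_prune
    by (subst (1) sum.remove[of _ k]) (use assms in \<open>auto simp: prune_trivial\<close>)
  then show ?thesis
    by (simp only: mset_map_shape_remove[OF assms])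
qed

lemma shape_prune_Cons:
  assumes "k < length ts" "e \<noteq> []"
  shows "shape (prune {k # e} (PNode i ts)) =
     Node i (mset (map shape ts) - {#shape (ts ! k)#} + {#shape (prune {e} (ts ! k))#})"
proof -
  have "shape (prune {k # e} (PNode i ts)) =
      Node i ((\<Sum>l\<in>{..<length ts} - {k}. {#shape (ts ! l)#}) + {#shape (prune {e} (ts ! k))#})"
    unfolding shape_prune
    by (subst (1) sum.remove[of _ k]) (use assms in \<open>auto simp: prune_trivial\<close>)
  then show ?thesis
    by (simp only: mset_map_shape_remove[OF assms(1)])
qed

text \<open>An edge of \<open>PNode i ts\<close> is either \<open>[k]\<close>, cutting off the whole
  child, or \<open>k # e\<close> with \<open>e\<close> an edge of that child; these are the two
  summands in the recursion of \<open>cut_branch\<close>. The right-hand side depends on the shape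
  only, so the chosen representative does not matter.\<close>

lemma cut_branch_shape:
  "(\<Sum>e\<in>edges p. if shape (subtree p e) = s then basis_elt {#shape (prune {e} p)#} else 0)
     = (cut_branch s (shape p) :: ('i, 'k::field) ck)"
proof (induction p)
  case (PNode i ts)
  define p where "p = PNode i ts"
  define F where "F = mset (map shape ts)"
  let ?g = "\<lambda>p e. if shape (subtree p e) = s then basis_elt {#shape (prune {e} p)#} else 0 :: ('i, 'k) ck"
  let ?h = "\<lambda>t. basis_elt (F - {#t#}) * (cut_branch s t + (if t = s then 1 else 0)) :: ('i, 'k) ck"
  have child: "(\<Sum>e\<in>(#) k ` insert [] (edges (ts ! k)). ?g p e) = graft i (?h (shape (ts ! k)))"
    if k: "k < length ts" for k
  proof -
    have "(\<Sum>e\<in>(#) k ` insert [] (edges (ts ! k)). ?g p e)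
        = ?g p [k] + (\<Sum>e\<in>edges (ts ! k). ?g p (k # e))"
    proof -
      have "[] \<notin> edges (ts ! k)"
        by (simp add: edges_def)
      then show ?thesis
        by (subst sum.reindex) (auto simp: finite_edges)
    qed
    also have "?g p [k] = graft i (basis_elt (F - {#shape (ts ! k)#}) * (if shape (ts ! k) = s then 1 else 0))"
      using k by (simp add: p_def F_def shape_prune_child graft_basis_elt del: prune.simps)
    also have "(\<Sum>e\<in>edges (ts ! k). ?g p (k # e))
        = (\<Sum>e\<in>edges (ts ! k). graft i (basis_elt (F - {#shape (ts ! k)#}) * ?g (ts ! k) e))"
      using k by (intro sum.cong)
        (auto simp: p_def F_def shape_prune_Cons graft_basis_elt edges_def basis_elt_mult simp del: prune.simps)
    also have "\<dots> = graft i (basis_elt (F - {#shape (ts ! k)#}) * cut_branch s (shape (ts ! k)))"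
      using k PNode.IH[of "ts ! k"] by (simp flip: graft_sum sum_distrib_left)
    finally show ?thesis
      by (simp add: distrib_left graft_add)
  qed
  have "(\<Sum>e\<in>edges p. ?g p e) = (\<Sum>k<length ts. \<Sum>e\<in>(#) k ` insert [] (edges (ts ! k)). ?g p e)"
    unfolding p_def edges_PNode by (rule sum.UNION_disjoint) (auto simp: finite_edges)
  also have "\<dots> = graft i (\<Sum>k<length ts. ?h (shape (ts ! k)))"
    unfolding graft_sum by (intro sum.cong refl child) simp
  also have "(\<Sum>k<length ts. ?h (shape (ts ! k))) = (\<Sum>t\<in>#F. ?h t)"
  proof -
    have "image_mset ?h F = mset (map (?h \<circ> shape) ts)"
      unfolding F_def mset_map multiset.map_comp ..
    then have "(\<Sum>t\<in>#F. ?h t) = sum_list (map (?h \<circ> shape) ts)"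
      by (simp only: sum_mset_sum_list)
    also have "\<dots> = (\<Sum>k<length ts. ?h (shape (ts ! k)))"
      by (simp add: sum_list_sum_nth atLeast0LessThan)
    finally show ?thesis ..
  qed
  finally show ?case
    unfolding p_def F_def shape.simps cut_branch.simps .
qed

text \<open>A cut \<open>c\<close> yields a forest of \<open>card c\<close> trees, so only cuts of a
  single edge have a tree on the left. The terms with an empty forest on one side do not
  contribute.\<close>

lemma lookup_coprod_tree:
  "lookup (coprod_tree t) ({#s#}, {#r#}) = (lookup (cut_branch s t) {#r#} :: 'k::field)"
proof -
  let ?p = "rep t"
  let ?g = "\<lambda>c. basis_elt (P_cut c ?p, {#R_cut c ?p#}) :: (_, 'k) ck2"
  have P_single: "P_cut {e} ?p = {#shape (subtree ?p e)#}" for e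
    by (simp add: P_cut_def prune_trivial)
  have "cuts ?p \<subseteq> Pow (edges ?p)"
    by (auto simp: cuts_def)
  then have fin: "finite (cuts ?p)"
    by (rule finite_subset) (simp add: finite_edges)
  have single: "(\<lambda>e. {e}) ` edges ?p \<subseteq> cuts ?p"
  proof -
    have "card {x \<in> {e}. prefix x q} \<le> 1" for e q :: "nat list"
      using card_mono[of "{e}" "{x \<in> {e}. prefix x q}"] by auto
    then show ?thesis
      by (auto simp: cuts_def)
  qed
  have zero: "lookup (?g c) ({#s#}, {#r#}) = 0" if "c \<in> cuts ?p - (\<lambda>e. {e}) ` edges ?p" for c
  proof -
    have "finite c"
      using that finite_subset[OF _ finite_edges] by (auto simp: cuts_def)
    then have "size (P_cut c ?p) = card c"
      unfolding P_cut_def by (induction c) auto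
    moreover have "card c \<noteq> 1"
      using that by (auto simp: card_1_singleton_iff cuts_def)
    ultimately have "P_cut c ?p \<noteq> {#s#}"
      by auto
    then show ?thesis
      by (simp add: lookup_basis_elt)
  qed
  have "lookup (coprod_tree t :: (_, 'k) ck2) ({#s#}, {#r#}) = (\<Sum>c\<in>cuts ?p. lookup (?g c) ({#s#}, {#r#}))"
    by (simp add: coprod_tree_def lookup_add lookup_sum lookup_basis_elt)
  also have "\<dots> = (\<Sum>c\<in>(\<lambda>e. {e}) ` edges ?p. lookup (?g c) ({#s#}, {#r#}))"
    by (rule sum.mono_neutral_right) (use fin single zero in auto)
  also have "\<dots> = (\<Sum>e\<in>edges ?p. lookup (?g {e}) ({#s#}, {#r#}))"
    by (subst sum.reindex) auto
  also have "\<dots> = (\<Sum>e\<in>edges ?p. lookup (if shape (subtree ?p e) = s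
      then basis_elt {#shape (prune {e} ?p)#} else 0) {#r#})"
    by (rule sum.cong) (auto simp: P_single R_cut_def lookup_basis_elt)
  also have "\<dots> = lookup (cut_branch s (shape ?p)) {#r#}"
    by (simp only: cut_branch_shape[symmetric] lookup_sum)
  finally show ?thesis
    by simp
qed

lemma coprod_basis_tree [simp]: "coprod (basis_elt {#t#}) = coprod_tree t"
  by (simp add: coprod_def)

lemma coprod_linear: "Vector_Spaces.linear scale scale coprod"
  unfolding coprod_def by (rule lin_ext_linear)

lemma shape_eq_single: "shape p = Node j {#} \<longleftrightarrow> children p = [] \<and> pdeco p = j"
  by (cases p) auto

text \<open>A non-root leaf decorated by \<open>j\<close> is the same as an edge whose upper part is
  the one-vertex tree, so the numbers defining \<open>sdse_lambda\<close> are coefficients of the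
  derivation for that tree.\<close>

lemma n_leaf_eq_lookup:
  "of_nat (n_leaf j t t') = (lookup (cut_branch (Node j {#}) t) {#t'#} :: 'k::field)"
proof -
  let ?p = "rep t"
  have "lookup (cut_branch (Node j {#}) t) {#t'#} = (\<Sum>e\<in>edges ?p. lookup (if shape (subtree ?p e) = Node j {#}
      then basis_elt {#shape (prune {e} ?p)#} else 0 :: (_, 'k) ck) {#t'#})"
    using cut_branch_shape[of ?p "Node j {#}", where 'k='k, symmetric] by (simp add: lookup_sum)
  also have "\<dots> = (\<Sum>e\<in>edges ?p. if e \<in> {e \<in> edges ?p. shape (subtree ?p e) = Node j {#} \<and>
      shape (prune {e} ?p) = t'} then 1 else 0)"
    by (rule sum.cong) (auto simp: lookup_basis_elt)
  also have "\<dots> = of_nat (card {e \<in> edges ?p. shape (subtree ?p e) = Node j {#} \<and> shape (prune {e} ?p) = t'})"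
    using finite_edges[of ?p] by (simp add: sum.If_cases Int_def conj_ac)
  also have "{e \<in> edges ?p. shape (subtree ?p e) = Node j {#} \<and> shape (prune {e} ?p) = t'}
      = {q \<in> leaves ?p \<inter> edges ?p. pdeco (subtree ?p q) = j \<and> shape (prune {q} ?p) = t'}"
    by (auto simp: shape_eq_single leaves_def edges_def)
  finally show ?thesis
    by (simp add: n_leaf_def)
qed

text \<open>A tree with at most \<open>Suc n\<close> vertices is a root decoration together with a
  multiset of at most \<open>n\<close> trees, each with at most \<open>n\<close> vertices.\<close>

lemma finite_nverts_le: "finite {t :: 'i::finite rtree. nverts t \<le> n}"
proof (induction n)
  case 0
  have "\<not> nverts t \<le> 0" for t :: "'i rtree"
    using nverts_pos[of t] by simp
  then have "{t :: 'i rtree. nverts t \<le> 0} = {}"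
    by blast
  then show ?case
    by (simp only: finite.emptyI)
next
  case (Suc n)
  let ?T = "{t :: 'i rtree. nverts t \<le> n}"
  have "{t :: 'i rtree. nverts t \<le> Suc n} \<subseteq>
      (\<lambda>(i, f). Node i f) ` (UNIV \<times> (\<Union>m\<le>n. multisets_of_size ?T m))"
  proof
    fix t :: "'i rtree" assume "t \<in> {t. nverts t \<le> Suc n}"
    moreover obtain i f where t: "t = Node i f" by (cases t)
    ultimately have le: "(\<Sum>\<^sub># (image_mset nverts f)) \<le> n" by simp
    have "set_mset f \<subseteq> ?T"
      using nverts_less[of _ f i] le by fastforce
    moreover have "size f \<le> (\<Sum>\<^sub># (image_mset nverts f))" for f :: "'i forest"
    proof (induction f)
      case (add x f)
      then show ?case using nverts_pos[of x] by simp
    qed simp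
    ultimately have "f \<in> (\<Union>m\<le>n. multisets_of_size ?T m)"
      using le by (force simp: multisets_of_size_def intro: order.trans)
    then show "t \<in> (\<lambda>(i, f). Node i f) ` (UNIV \<times> (\<Union>m\<le>n. multisets_of_size ?T m))"
      using t by force
  qed
  moreover have "finite ((\<lambda>(i, f). Node i f) ` ((UNIV :: 'i set) \<times> (\<Union>m\<le>n. multisets_of_size ?T m)))"
    using Suc by (intro finite_imageI finite_cartesian_product finite_UN_I finite_multisets_of_size) auto
  ultimately show ?case
    by (rule finite_subset)
qed

lemma finite_trees: "finite (trees i n :: 'i::finite rtree set)"
  by (rule finite_subset[OF _ finite_nverts_le[of n]]) (auto simp: trees_def)

section \<open>Solutions of the system\<close>

lemma fps_nth_prod_0: "fps_nth (\<Prod>a\<in>A. f a) 0 = (\<Prod>a\<in>A. fps_nth (f a :: 'a::comm_ring_1 fps) 0)"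
  by (induction A rule: infinite_finite_induct) auto

lemma finite_sum_le: "finite {p :: 'i::finite \<Rightarrow> nat. sum p UNIV \<le> n}"
proof -
  have "{p :: 'i \<Rightarrow> nat. sum p UNIV \<le> n} \<subseteq>
      {p. \<forall>j. (j \<in> UNIV \<longrightarrow> p j \<in> {..n}) \<and> (j \<notin> UNIV \<longrightarrow> p j = 0)}"
  proof
    fix p :: "'i \<Rightarrow> nat" assume "p \<in> {p. sum p UNIV \<le> n}"
    moreover have "p j \<le> sum p UNIV" for j
      by (rule member_le_sum) auto
    ultimately show "p \<in> {p. \<forall>j. (j \<in> UNIV \<longrightarrow> p j \<in> {..n}) \<and> (j \<notin> UNIV \<longrightarrow> p j = 0)}"
      by (auto intro: order.trans)
  qed
  then show ?thesis
    by (rule finite_subset) (rule finite_set_of_finite_funs, auto)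
qed

locale sdse =
  fixes F :: "'i::finite \<Rightarrow> ('i, 'k::field_char_0) mps"
    and X :: "'i \<Rightarrow> ('i, 'k) ck fps"
  assumes F_0: "F i (\<lambda>_. 0) = 1"
    and solution: "sdse_solution F X"
begin

abbreviation a where "a \<equiv> tree_coeff X"

definition Y where "Y i = eval_mps (F i) X"

definition mon :: "('i \<Rightarrow> nat) \<Rightarrow> ('i, 'k) ck fps" where
  "mon p = (\<Prod>j\<in>UNIV. X j ^ p j)"

lemma X_eq: "X i = graft_hat i (Y i)"
  using solution unfolding sdse_solution_def Y_def by blast

lemma X_0 [simp]: "fps_nth (X i) 0 = 0"
  by (subst X_eq) (simp add: graft_hat_def)

lemma X_Suc: "fps_nth (X i) (Suc n) = graft i (fps_nth (Y i) n)"
  by (subst X_eq) (simp add: graft_hat_def)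

lemma mon_0: "mon (\<lambda>_. 0) = 1"
  by (simp add: mon_def)

text \<open>Every \<open>X j\<close> has zero constant term and is divisible by the bookkeeping
  variable. Hence \<open>mon p\<close> starts in degree \<open>sum p UNIV\<close>, which makes
  \<open>eval_mps\<close> a finite sum in each degree.\<close>

lemma mon_eq_X_power_mult:
  "mon p = fps_X ^ (sum p UNIV) * (\<Prod>j\<in>UNIV. fps_shift 1 (X j) ^ p j)"
proof -
  have "X j = fps_X * fps_shift 1 (X j)" for j
    by (rule fps_ext) simp
  then have "mon p = (\<Prod>j\<in>UNIV. (fps_X * fps_shift 1 (X j)) ^ p j)"
    unfolding mon_def by metis
  then show ?thesis
    by (simp add: power_mult_distrib prod.distrib power_sum)
qed

lemma mon_nth_less: "n < sum p UNIV \<Longrightarrow> fps_nth (mon p) n = 0"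
  and mon_nth_sum: "fps_nth (mon p) (sum p UNIV) = (\<Prod>j\<in>UNIV. fps_nth (X j) 1 ^ p j)"
  unfolding mon_eq_X_power_mult fps_X_power_mult_nth by (simp_all add: fps_nth_prod_0 fps_power_zeroth)

text \<open>The bound \<open>m\<close> may exceed \<open>n\<close>, so that two different
  coefficients of \<open>Y i\<close> can be expanded over one common index set, as in
  \<open>shift_deriv_Y\<close>.\<close>

lemma Y_nth:
  assumes "n \<le> m"
  shows "fps_nth (Y i) n = (\<Sum>p | sum p UNIV \<le> m. scale (F i p) (fps_nth (mon p) n))"
proof -
  have "fps_nth (Y i) n = Sum_any (\<lambda>p. scale (F i p) (fps_nth (mon p) n))"
    by (simp add: Y_def eval_mps_def mon_def)
  also have "\<dots> = (\<Sum>p | sum p UNIV \<le> m. scale (F i p) (fps_nth (mon p) n))"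
  proof (rule Sum_any.expand_superset)
    show "{p. scale (F i p) (fps_nth (mon p) n) \<noteq> 0} \<subseteq> {p. sum p UNIV \<le> m}"
    proof
      fix p assume "p \<in> {p. scale (F i p) (fps_nth (mon p) n) \<noteq> 0}"
      then have "fps_nth (mon p) n \<noteq> 0"
        by auto
      then have "\<not> n < sum p UNIV"
        using mon_nth_less by blast
      then show "p \<in> {p. sum p UNIV \<le> m}"
        using assms by simp
    qed
  qed (rule finite_sum_le)
  finally show ?thesis .
qed

lemma X_1: "fps_nth (X i) 1 = basis_elt {#Node i {#}#}"
proof -
  have "{p :: 'i \<Rightarrow> nat. sum p UNIV \<le> 0} = {\<lambda>_. 0}"
    by auto
  then show ?thesis
    using X_Suc[of i 0] Y_nth[of 0 0 i] graft_basis_elt[of i 0]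
    by (simp add: mon_0 F_0 basis_elt_zero)
qed

lemma lookup_X_nonzero:
  assumes "lookup (fps_nth (X i) n) f \<noteq> 0"
  shows "\<exists>t\<in>trees i n. f = {#t#}"
proof (cases n)
  case 0
  with assms show ?thesis by simp
next
  case (Suc m)
  with assms obtain g where f: "f = {#Node i g#}"
    using lookup_graft_nonzero[of i "fps_nth (Y i) m" f] by (auto simp: X_Suc)
  have "fps_nth (X i) n \<in> homog n"
    using solution by (auto simp: sdse_solution_def completion_def)
  moreover have "{#Node i g#} \<in> keys (fps_nth (X i) n)"
    using assms by (simp add: in_keys_iff f)
  ultimately have "nverts (Node i g) = n"
    by (fastforce simp: homog_def)
  then show ?thesis
    using f by (auto simp: trees_def)
qed

lemma lookup_X: "lookup (fps_nth (X i) n) {#t#} = (if t \<in> trees i n then a t else 0)"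
  using lookup_X_nonzero[of i n "{#t#}"] by (auto simp: tree_coeff_def trees_def)

lemma lookup_X_0: "lookup (fps_nth (X i) n) 0 = 0"
  using lookup_X_nonzero[of i n 0] by auto

lemma X_expand: "fps_nth (X i) n = (\<Sum>t\<in>trees i n. scale (a t) (basis_elt {#t#}))"
proof (rule poly_mapping_eqI)
  fix f
  show "lookup (fps_nth (X i) n) f = lookup (\<Sum>t\<in>trees i n. scale (a t) (basis_elt {#t#})) f"
  proof (cases "\<exists>t\<in>trees i n. f = {#t#}")
    case True
    then obtain t where t: "t \<in> trees i n" "f = {#t#}" by blast
    then show ?thesis
      by (simp add: lookup_sum lookup_basis_elt lookup_X finite_trees if_distrib
          sum.delta cong: if_cong)
  next
    case False
    then have "lookup (fps_nth (X i) n) f = 0"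
      using lookup_X_nonzero by blast
    moreover have "lookup (\<Sum>t\<in>trees i n. scale (a t) (basis_elt {#t#})) f = 0"
      unfolding lookup_sum by (rule sum.neutral) (use False in \<open>auto simp: lookup_basis_elt\<close>)
    ultimately show ?thesis
      by simp
  qed
qed

lemma a_dot [simp]: "a (Node i {#}) = 1"
  using X_1[of i] by (simp add: tree_coeff_def lookup_basis_elt)

text \<open>Since \<open>X i\<close> is a combination of trees, \<open>lookup_coprod_tree\<close>
  extends linearly. The constant by which \<open>branch_deriv\<close> and \<open>cut_branch\<close>
  differ has no tree coefficient.\<close>

lemma lookup_coprod_X:
  "lookup (coprod (fps_nth (X i) n)) ({#s#}, {#r#}) = lookup (branch_deriv s (fps_nth (X i) n)) {#r#}"
proof -
  interpret coprod: module_hom scale scale "coprod :: ('i, 'k) ck \<Rightarrow> _"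
    using coprod_linear by (simp only: Vector_Spaces.linear_iff_module_hom)
  show ?thesis
    by (subst (1 2) X_expand) (simp add: lookup_branch_deriv_tree lookup_coprod_tree coprod.sum coprod.scale branch_deriv_sum branch_deriv_scale lookup_sum)
qed

text \<open>
  For a tree \<open>s\<close> with root decoration \<open>j\<close> and degree \<open>l\<close>, the derivation
  \<open>Z D\<^sub>s - a\<^sub>s Z\<^sup>l D\<^sub>j\<close> of the power series ring (\<open>D\<^sub>j\<close> standing for the one-vertex tree
  decorated by \<open>j\<close>) commutes with grafting on the solution of the system, and so it kills it.
\<close>

definition shift_deriv :: "'i rtree \<Rightarrow> ('i, 'k) ck fps \<Rightarrow> ('i, 'k) ck fps" where
  "shift_deriv s x = fps_X * Abs_fps (\<lambda>n. branch_deriv s (fps_nth x n))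
     - fps_const (Poly_Mapping.single 0 (a s)) * (fps_X ^ nverts s *
         Abs_fps (\<lambda>n. branch_deriv (Node (root_deco s) {#}) (fps_nth x n)))"

lemma shift_deriv_nth_0 [simp]: "fps_nth (shift_deriv s x) 0 = 0"
  using nverts_pos[of s] by (simp add: shift_deriv_def)

text \<open>For \<open>x\<close> in the completion the factors \<open>fps_X\<close> and
  \<open>fps_X ^ nverts s\<close> align the degrees: both terms have degree
  \<open>n - nverts s\<close> when \<open>nverts s \<le> n\<close>.\<close>

lemma shift_deriv_nth_Suc: "fps_nth (shift_deriv s x) (Suc n) = branch_deriv s (fps_nth x n)
   - (if nverts s \<le> Suc n then scale (a s) (branch_deriv (Node (root_deco s) {#}) (fps_nth x (Suc n - nverts s))) else 0)"
  by (simp add: shift_deriv_def fps_X_power_mult_nth scale_eq_mult)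

lemma shift_deriv_mult: "shift_deriv s (x * y) = shift_deriv s x * y + x * shift_deriv s y"
proof -
  have "Abs_fps (\<lambda>n. branch_deriv s (fps_nth (x * y) n)) =
      Abs_fps (\<lambda>n. branch_deriv s (fps_nth x n)) * y + x * Abs_fps (\<lambda>n. branch_deriv s (fps_nth y n))" for s
    by (rule fps_ext) (simp add: fps_mult_nth branch_deriv_sum branch_deriv_mult sum.distrib)
  then show ?thesis
    by (simp add: shift_deriv_def algebra_simps)
qed

lemma shift_deriv_one: "shift_deriv s 1 = 0"
  using shift_deriv_mult[of s 1 1] by simp

text \<open>By the Leibniz rule, the series whose derivative vanishes up to order \<open>m\<close>
  contain \<open>1\<close> and are closed under products.\<close>

lemma shift_deriv_mon:
  assumes "\<And>j n. n \<le> m \<Longrightarrow> fps_nth (shift_deriv s (X j)) n = 0" "n \<le> m"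
  shows "fps_nth (shift_deriv s (mon p)) n = 0"
proof -
  define Q where "Q x \<longleftrightarrow> (\<forall>n\<le>m. fps_nth (shift_deriv s x) n = 0)" for x
  have one: "Q 1"
    by (simp add: Q_def shift_deriv_one)
  have mult: "Q (x * y)" if "Q x" "Q y" for x y
    using that by (auto simp: Q_def shift_deriv_mult fps_mult_nth intro!: sum.neutral)
  have power: "Q (x ^ k)" if "Q x" for x k
    by (induction k) (auto intro: one mult that)
  have "Q (X j)" for j
    using assms(1) by (simp add: Q_def)
  then have "Q (\<Prod>j\<in>A. X j ^ p j)" for A
    by (induction A rule: infinite_finite_induct) (auto intro: one mult power)
  then show ?thesis
    using assms(2) by (simp add: Q_def mon_def)
qed

lemma shift_deriv_Y:
  "fps_nth (shift_deriv s (Y i)) n =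
     (\<Sum>p | sum p UNIV \<le> n. scale (F i p) (fps_nth (shift_deriv s (mon p)) n))"
proof (cases n)
  case 0
  then show ?thesis by simp
next
  case (Suc m)
  have "m \<le> n" "Suc m - nverts s \<le> n"
    using Suc by auto
  then show ?thesis
    by (simp add: Suc shift_deriv_nth_Suc Y_nth[where m=n and i=i, unfolded Suc] branch_deriv_sum
        branch_deriv_scale free.scale_right_diff_distrib sum_subtractf free.scale_sum_right mult.commute)
qed

text \<open>By \<open>branch_deriv_graft\<close> only the constants from total cuts could prevent
  commutation with grafting. The first derivation produces \<open>a s\<close> from
  \<open>X i\<close> in degree \<open>nverts s\<close>, the second \<open>a s\<close> times the
  coefficient 1 of the one-vertex tree. Both occur at index \<open>Suc (nverts s)\<close> and
  cancel.\<close>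

lemma shift_deriv_X_Suc:
  "fps_nth (shift_deriv s (X i)) (Suc n) = graft i (fps_nth (shift_deriv s (Y i)) n)"
proof (cases n)
  case 0
  then show ?thesis
    using nverts_pos[of s] by (auto simp: shift_deriv_nth_Suc)
next
  case (Suc m)
  define l where "l = nverts s"
  define dot where "dot = Node (root_deco s) ({#} :: 'i forest)"
  have l: "l > 0"
    by (simp add: l_def nverts_pos)
  have bd: "branch_deriv u (fps_nth (X i) (Suc k)) =
      graft i (branch_deriv u (fps_nth (Y i) k)) + Poly_Mapping.single 0 (lookup (fps_nth (X i) (Suc k)) {#u#})"
    for u k
    by (simp add: X_Suc branch_deriv_graft)
  have lookup_s: "lookup (fps_nth (X i) (Suc m)) {#s#} = (if root_deco s = i \<and> l = Suc m then a s else 0)"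
    by (auto simp: lookup_X trees_def l_def)
  have lookup_dot: "lookup (fps_nth (X i) (Suc k)) {#dot#} = (if root_deco s = i \<and> k = 0 then 1 else 0)" for k
    by (auto simp: lookup_X trees_def dot_def)
  have scale_single: "scale c (Poly_Mapping.single (0 :: 'i forest) d) = Poly_Mapping.single 0 (c * d)" for c d :: 'k
    by (simp add: scale_eq_mult mult_single)
  \<comment> \<open>In the first case the second term is cut off on both sides. In the middle case
    it is cut off on the right and involves \<open>X i\<close> in degree 0, which is zero, on the
    left. In the last case both terms are present, and constants occur only for
    \<open>k = 0\<close>.\<close>
  consider "l > Suc (Suc m)" | "l = Suc (Suc m)" | k where "l + k = Suc m"
    by (metis le_add_diff_inverse less_Suc_eq_le linorder_neqE_nat)
  then show ?thesis
  proof cases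
    case 1
    then show ?thesis
      by (simp add: Suc shift_deriv_nth_Suc bd lookup_s flip: l_def dot_def)
  next
    case 2
    then show ?thesis
      by (simp add: Suc shift_deriv_nth_Suc bd lookup_s flip: l_def dot_def)
  next
    case 3
    then have "Suc (Suc m) - l = Suc k" "Suc m - l = k" "l = Suc m \<longleftrightarrow> k = 0" "l \<le> Suc (Suc m)" "l \<le> Suc m"
      by auto
    then show ?thesis
      by (simp add: Suc shift_deriv_nth_Suc bd lookup_s lookup_dot graft_diff graft_scale
          free.scale_right_distrib scale_single flip: l_def dot_def)
  qed
qed

text \<open>The derivatives satisfy a homogeneous system: the coefficient at \<open>Suc m\<close> is
  grafted from an expression in the coefficients up to \<open>m\<close>, so all vanish by
  induction.\<close>

lemma shift_deriv_X: "shift_deriv s (X i) = 0"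
proof -
  have "\<forall>i. fps_nth (shift_deriv s (X i)) n = 0" for n
  proof (induction n rule: less_induct)
    case (less n)
    show ?case
    proof (cases n)
      case (Suc m)
      with less have "fps_nth (shift_deriv s (mon p)) m = 0" for p
        using shift_deriv_mon[of m s m] by auto
      then show ?thesis
        by (simp add: Suc shift_deriv_X_Suc shift_deriv_Y)
    qed simp
  qed
  then show ?thesis
    by (intro fps_ext) simp
qed

lemma branch_deriv_X:
  "branch_deriv s (fps_nth (X i) (k + nverts s)) =
     scale (a s) (branch_deriv (Node (root_deco s) {#}) (fps_nth (X i) (Suc k)))"
proof -
  have "fps_nth (shift_deriv s (X i)) (Suc (k + nverts s)) = 0"
    by (simp add: shift_deriv_X)
  moreover have "Suc (k + nverts s) - nverts s = Suc k"
    by simp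
  ultimately show ?thesis
    by (simp add: shift_deriv_nth_Suc)
qed

lemma sum_n_leaf:
  "(\<Sum>t\<in>trees i n. of_nat (n_leaf j t r) * a t)
     = lookup (branch_deriv (Node j {#}) (fps_nth (X i) n)) {#r#}"
  by (subst X_expand) (simp add: branch_deriv_sum branch_deriv_scale lookup_branch_deriv_tree
      lookup_sum n_leaf_eq_lookup mult.commute)

end

lemma sum_mset_if_eq: "(\<Sum>t\<in>#M. if t = u then c else 0) = scale (of_nat (count M u)) (c :: 'b \<Rightarrow>\<^sub>0 'k::field)"
  by (induction M) (auto simp: free.scale_left_distrib)

section \<open>Hopf systems\<close>

locale hopf_sdse = sdse F X
  for F :: "'i::finite \<Rightarrow> ('i, 'k::field_char_0) mps"
    and X :: "'i \<Rightarrow> ('i, 'k) ck fps" +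
  assumes nonconst: "nonconstant (F i)"
    and hopf: "hopf_subalgebra (H_S X)"
begin

section \<open>The subalgebra of the system and tree coefficients of its elements\<close>

abbreviation H where "H \<equiv> H_S X"

lemma subalgebra_H: "subalgebra H"
  using hopf by (simp add: hopf_subalgebra_def)

lemma X_in_H: "fps_nth (X i) n \<in> H"
  by (auto simp: H_S_def generated_subalgebra_def)

lemma H_subset:
  assumes "subalgebra A" and "\<And>i n. fps_nth (X i) n \<in> A"
  shows "H \<subseteq> A"
  unfolding H_S_def generated_subalgebra_def using assms by (intro Inter_lower) auto

lemma subspace_H: "free.subspace H"
  and one_in_H: "1 \<in> H"
  and mult_in_H: "x \<in> H \<Longrightarrow> y \<in> H \<Longrightarrow> x * y \<in> H"
  using subalgebra_H by (auto simp: subalgebra_def)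

lemmas add_in_H = free.subspace_add[OF subspace_H]
  and scale_in_H = free.subspace_scale[OF subspace_H]

text \<open>The elements with this property form a subalgebra because tree coefficients obey
  \<open>lookup_single_mset_mult\<close>. It contains the generators: the constant is 1 for
  \<open>X j\<close> in degree \<open>l\<close> and 0 for every other component.\<close>

lemma lookup_H_trees:
  assumes "u \<in> H"
  shows "\<exists>c. \<forall>s\<in>trees j l. lookup u {#s#} = c * a s"
proof -
  define A where "A = {u. \<exists>c. \<forall>s\<in>trees j l. lookup u {#s#} = c * a s}"
  have "subalgebra A"
    unfolding subalgebra_def free.subspace_def
  proof (intro conjI ballI allI)
    show "0 \<in> A" "1 \<in> A"
      by (auto simp: A_def lookup_one when_def intro: exI[of _ 0])
    fix x y c assume "x \<in> A" "y \<in> A"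
    then obtain d e where de: "\<forall>s\<in>trees j l. lookup x {#s#} = d * a s" "\<forall>s\<in>trees j l. lookup y {#s#} = e * a s"
      by (auto simp: A_def)
    then have "\<forall>s\<in>trees j l. lookup (x + y) {#s#} = (d + e) * a s"
      by (simp add: lookup_add distrib_right)
    then show "x + y \<in> A"
      unfolding A_def by blast
    have "\<forall>s\<in>trees j l. lookup (x * y) {#s#} = (lookup x 0 * e + d * lookup y 0) * a s"
      using de by (simp add: lookup_single_mset_mult algebra_simps)
    then show "x * y \<in> A"
      unfolding A_def by blast
  next
    fix x c assume "x \<in> A"
    then obtain d where "\<forall>s\<in>trees j l. lookup x {#s#} = d * a s"
      by (auto simp: A_def)
    then have "\<forall>s\<in>trees j l. lookup (scale c x) {#s#} = (c * d) * a s"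
      by simp
    then show "scale c x \<in> A"
      unfolding A_def by blast
  qed
  moreover have "fps_nth (X i) n \<in> A" for i n
  proof -
    have "\<forall>s\<in>trees j l. lookup (fps_nth (X i) n) {#s#} = (if i = j \<and> n = l then 1 else 0) * a s"
      by (auto simp: lookup_X trees_def)
    then show ?thesis
      unfolding A_def by blast
  qed
  ultimately have "H \<subseteq> A"
    by (rule H_subset)
  then show ?thesis
    using assms by (auto simp: A_def)
qed

lemma lookup_tensor_set_trees:
  assumes "z \<in> tensor_set H"
  shows "\<exists>c. \<forall>s\<in>trees j l. \<forall>r\<in>trees i k. lookup z ({#s#}, {#r#}) = c * a s * a r"
proof -
  define A where "A = {z. \<exists>c. \<forall>s\<in>trees j l. \<forall>r\<in>trees i k. lookup z ({#s#}, {#r#}) = c * a s * a r}"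
  have "free.subspace A"
    unfolding free.subspace_def
  proof (intro conjI ballI allI)
    show "0 \<in> A"
      by (auto simp: A_def intro: exI[of _ 0])
    fix x y assume "x \<in> A" "y \<in> A"
    then obtain d e where de: "\<forall>s\<in>trees j l. \<forall>r\<in>trees i k. lookup x ({#s#}, {#r#}) = d * a s * a r"
      "\<forall>s\<in>trees j l. \<forall>r\<in>trees i k. lookup y ({#s#}, {#r#}) = e * a s * a r"
      unfolding A_def by blast
    then have "\<forall>s\<in>trees j l. \<forall>r\<in>trees i k. lookup (x + y) ({#s#}, {#r#}) = (d + e) * a s * a r"
      by (simp add: lookup_add distrib_right)
    then show "x + y \<in> A"
      unfolding A_def by blast
  next
    fix x c assume "x \<in> A"
    then obtain d where "\<forall>s\<in>trees j l. \<forall>r\<in>trees i k. lookup x ({#s#}, {#r#}) = d * a s * a r"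
      unfolding A_def by blast
    then have "\<forall>s\<in>trees j l. \<forall>r\<in>trees i k. lookup (scale c x) ({#s#}, {#r#}) = (c * d) * a s * a r"
      by simp
    then show "scale c x \<in> A"
      unfolding A_def by blast
  qed
  moreover have "{tensor u v | u v. u \<in> H \<and> v \<in> H} \<subseteq> A"
  proof clarify
    fix u v assume "u \<in> H" "v \<in> H"
    then obtain d e where "\<forall>s\<in>trees j l. lookup u {#s#} = d * a s" "\<forall>r\<in>trees i k. lookup v {#r#} = e * a r"
      using lookup_H_trees by meson
    then have "\<forall>s\<in>trees j l. \<forall>r\<in>trees i k. lookup (tensor u v) ({#s#}, {#r#}) = (d * e) * a s * a r"
      by simp
    then show "tensor u v \<in> A"
      unfolding A_def by blast
  qed
  ultimately have "tensor_set H \<subseteq> A"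
    unfolding tensor_set_def by (intro free.span_minimal)
  then show ?thesis
    using assms by (auto simp: A_def)
qed

text \<open>Here stability under the coproduct enters: the coefficients of an element of the tensor
  square of \<open>H\<close> are proportional to \<open>a s * a r\<close>.\<close>

lemma lookup_branch_deriv_X:
  "\<exists>c. \<forall>s\<in>trees j l. \<forall>r\<in>trees i k.
     lookup (branch_deriv s (fps_nth (X m) n)) {#r#} = c * a s * a r"
proof -
  have "coprod (fps_nth (X m) n) \<in> tensor_set H"
    using hopf X_in_H by (auto simp: hopf_subalgebra_def)
  from lookup_tensor_set_trees[OF this] show ?thesis
    by (simp add: lookup_coprod_X)
qed

text \<open>
  Otherwise let \<open>m \<ge> 2\<close> be the least positive degree occurring in \<open>F i\<close>. Then \<open>X i\<close> has no
  component of degree \<open>m\<close>, yet removing one leaf from its component of degree \<open>m + 1\<close>, which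
  consists of corollas, does not give zero.
\<close>

lemma F_linear: "\<exists>p. sum p UNIV = 1 \<and> F i p \<noteq> 0"
proof -
  define Q where "Q m \<longleftrightarrow> (\<exists>p. sum p UNIV = m \<and> 0 < m \<and> F i p \<noteq> 0)" for m
  obtain p0 where "p0 \<noteq> (\<lambda>_. 0)" "F i p0 \<noteq> 0"
    using nonconst unfolding nonconstant_def by blast
  moreover from this have "sum p0 UNIV \<noteq> 0"
    by (auto simp: fun_eq_iff)
  ultimately have "Q (sum p0 UNIV)"
    unfolding Q_def by blast
  then have Q_Least: "Q (LEAST m. Q m)"
    by (rule LeastI)
  define m where "m = (LEAST m. Q m)"
  have "Q m"
    unfolding m_def by (rule Q_Least)
  then obtain q where q: "sum q UNIV = m" "0 < m" "F i q \<noteq> 0"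
    unfolding Q_def by blast
  have low: "F i p = 0" if "sum p UNIV < m" "0 < sum p UNIV" for p
  proof -
    have "\<not> Q (sum p UNIV)"
      using that(1) unfolding m_def by (rule not_less_Least)
    then show ?thesis
      using that(2) unfolding Q_def by blast
  qed
  \<comment> \<open>Below degree \<open>m\<close> only the monomial 1 has a nonzero coefficient in
    \<open>F i\<close>, and it lives in degree 0.\<close>
  have zero: "scale (F i p) (fps_nth (mon p) n) = 0" if "sum p UNIV < m" "0 < n" for p n
  proof (cases "sum p UNIV = 0")
    case True
    then have "p = (\<lambda>_. 0)"
      by (auto simp: fun_eq_iff)
    then show ?thesis
      using that by (simp add: mon_0)
  next
    case False
    then have "F i p = 0"
      using low that by blast
    then show ?thesis
      by simp
  qed
  show ?thesis
  proof (cases "m = 1")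
    case False
    with q have m: "m \<ge> 2" by simp
    then obtain m' where m': "m = Suc m'" "0 < m'"
      by (cases m) auto
    have "fps_nth (Y i) m' = 0"
      unfolding Y_nth[OF order_refl] using m' by (intro sum.neutral ballI zero) auto
    then have X_m: "fps_nth (X i) m = 0"
      by (simp add: m' X_Suc)
    obtain j where j: "0 < q j"
      using q by (metis gr0I less_irrefl sum.neutral)
    \<comment> \<open>This forest of single vertices is the lowest homogeneous term of
      \<open>mon p\<close>; its graft is a corolla.\<close>
    define corolla where "corolla p = (\<Sum>k\<in>UNIV. replicate_mset (p k) (Node k ({#} :: 'i forest)))" for p
    have count_corolla: "count (corolla p) (Node k {#}) = p k" for p k
      by (simp add: corolla_def count_sum sum.delta)
    have corolla_dot: "\<exists>k. t = Node k {#}" if "t \<in># corolla p" for t p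
      using that by (auto simp: corolla_def set_mset_sum)
    have mon_m: "fps_nth (mon p) m = basis_elt (corolla p)" if "sum p UNIV = m" for p
    proof -
      have power: "basis_elt {#t#} ^ n = (basis_elt (replicate_mset n t) :: ('i, 'k) ck)" for t n
        by (induction n) (simp_all add: basis_elt_mult basis_elt_zero)
      have "(\<Prod>k\<in>A. basis_elt {#Node k {#}#} ^ p k)
          = (basis_elt (\<Sum>k\<in>A. replicate_mset (p k) (Node k {#})) :: ('i, 'k) ck)" for A
        by (induction A rule: infinite_finite_induct) (simp_all add: basis_elt_mult basis_elt_zero power)
      then show ?thesis
        using mon_nth_sum[of p] that unfolding X_1 by (simp add: corolla_def)
    qed
    define dot where "dot = Node j ({#} :: 'i forest)"
    \<comment> \<open>Single vertices have no edges, so only the removal of whole trees equal to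
      \<open>dot\<close> contributes.\<close>
    have bd: "branch_deriv dot (basis_elt (corolla p) :: ('i, 'k) ck)
        = scale (of_nat (p j)) (basis_elt (corolla p - {#dot#}))" for p
    proof -
      have "basis_elt (corolla p - {#t#}) * (cut_branch dot t + (if t = dot then 1 else 0))
          = (if t = dot then basis_elt (corolla p - {#dot#}) else 0 :: ('i, 'k) ck)"
        if "t \<in># corolla p" for t
        using corolla_dot[OF that] by (auto simp: dot_def)
      then have "branch_deriv dot (basis_elt (corolla p) :: ('i, 'k) ck)
          = (\<Sum>t\<in>#corolla p. if t = dot then basis_elt (corolla p - {#dot#}) else 0)"
        unfolding branch_deriv_basis by (intro arg_cong[where f = sum_mset] image_mset_cong)
      then show ?thesis
        unfolding sum_mset_if_eq by (simp add: dot_def count_corolla)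
    qed
    \<comment> \<open>At this forest only \<open>p = q\<close> contributes, as putting
      \<open>dot\<close> back recovers \<open>corolla q\<close> and thus the exponents. Its
      coefficient is \<open>F i q\<close> times the nonzero integer \<open>q j\<close>; here
      characteristic zero is used.\<close>
    define f where "f = corolla q - {#dot#}"
    have "branch_deriv dot (fps_nth (Y i) m) =
        (\<Sum>p | sum p UNIV \<le> m. branch_deriv dot (scale (F i p) (fps_nth (mon p) m)))"
      by (simp add: Y_nth[OF order_refl] branch_deriv_sum)
    then have "lookup (branch_deriv dot (fps_nth (Y i) m)) f =
        (\<Sum>p | sum p UNIV \<le> m. lookup (branch_deriv dot (scale (F i p) (fps_nth (mon p) m))) f)"
      by (simp add: lookup_sum)
    also have "\<dots> = (\<Sum>p | sum p UNIV \<le> m. if p = q then F i q * of_nat (q j) else 0)"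
    proof (rule sum.cong)
      fix p :: "'i \<Rightarrow> nat" assume "p \<in> {p. sum p UNIV \<le> m}"
      then consider "sum p UNIV < m" | "sum p UNIV = m"
        by fastforce
      then show "lookup (branch_deriv dot (scale (F i p) (fps_nth (mon p) m))) f
          = (if p = q then F i q * of_nat (q j) else 0)"
      proof cases
        case 1
        then show ?thesis
          using zero[OF 1 q(2)] q(1) by auto
      next
        case 2
        have "p = q" if "0 < p j" "corolla p - {#dot#} = f"
        proof -
          have "dot \<in># corolla p" "dot \<in># corolla q"
            using that j count_corolla by (simp_all add: dot_def flip: count_greater_zero_iff)
          then have "corolla p = corolla q"
            using that(2) unfolding f_def by (metis insert_DiffM)
          then show "p = q"
            by (intro ext) (metis count_corolla)
        qed
        then show ?thesis
          by (auto simp: mon_m[OF 2] branch_deriv_scale bd lookup_basis_elt f_def)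
      qed
    qed simp
    also have "\<dots> = F i q * of_nat (q j)"
      using q by (simp add: finite_sum_le)
    finally have nonzero: "lookup (branch_deriv dot (fps_nth (Y i) m)) f \<noteq> 0"
      using q j by simp
    have "\<Sum>\<^sub># (image_mset nverts (corolla q)) = m"
    proof -
      have "\<Sum>\<^sub># (image_mset nverts (\<Sum>k\<in>A. replicate_mset (q k) (Node k ({#} :: 'i forest)))) = sum q A" for A
        by (induction A rule: infinite_finite_induct) auto
      then show ?thesis
        using q by (simp add: corolla_def)
    qed
    moreover have "corolla q = add_mset dot f"
      using j count_corolla[of q j] by (simp add: f_def dot_def flip: count_greater_zero_iff)
    ultimately have "\<Sum>\<^sub># (image_mset nverts f) + 1 = m"
      by (simp add: dot_def)
    then have r: "Node i f \<in> trees i m" and "dot \<in> trees j 1"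
      by (auto simp: trees_def dot_def)
    \<comment> \<open>Since \<open>X i\<close> vanishes in degree \<open>m\<close>,
      \<open>a (Node i f) = 0\<close>, and proportionality forces this coefficient to vanish. By
      \<open>branch_deriv_graft\<close> it equals the nonzero coefficient found above.\<close>
    then have "lookup (branch_deriv dot (fps_nth (X i) (Suc m))) {#Node i f#} = 0"
      using lookup_branch_deriv_X[of j 1 i m i "Suc m"] lookup_X[of i m "Node i f"] by (auto simp: X_m)
    then show ?thesis
      using nonzero by (simp add: X_Suc branch_deriv_graft lookup_add lookup_graft lookup_single)
  qed (use q in blast)
qed

text \<open>If \<open>F i\<close> contains the linear monomial in the indeterminate
  \<open>j\<close>, and \<open>t\<close> with root \<open>j\<close> has a nonzero coefficient, then
  so does \<open>Node i {#t#}\<close>. The induction is over all root decorations at once, since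
  \<open>j\<close> may differ from \<open>i\<close>.\<close>

lemma ex_nonzero_tree: "1 \<le> n \<Longrightarrow> \<exists>t\<in>trees i n. a t \<noteq> 0"
proof (induction n arbitrary: i rule: dec_induct)
  case base
  have "Node i {#} \<in> trees i 1"
    by (simp add: trees_def)
  then show ?case
    using a_dot by (metis zero_neq_one)
next
  case (step n)
  obtain p where p: "sum p UNIV = 1" "F i p \<noteq> 0"
    using F_linear by blast
  obtain j where "p j = 1" "\<forall>k. j \<noteq> k \<longrightarrow> p k = 0"
    using iffD1[OF sum_eq_1_iff p(1)] by auto
  then have p_j: "p = (\<lambda>k. if k = j then 1 else 0)"
    by auto
  have mon_unit: "mon (\<lambda>k. if k = j then 1 else 0) = X j" for j
    by (simp add: mon_def if_distrib prod.delta cong: if_cong)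
  obtain t where t: "t \<in> trees j n" "a t \<noteq> 0"
    using step.IH by blast
  \<comment> \<open>Such a \<open>q\<close> is zero, a different single indeterminate, or has at
    least two factors. These fail respectively by degree, by root decoration, and because a product
    of two elements without constant term contains no single tree.\<close>
  have other: "lookup (fps_nth (mon q) n) {#t#} = 0" if "q \<noteq> p" for q
  proof (cases "q = (\<lambda>_. 0)")
    case True
    then show ?thesis
      using step.hyps by (simp add: mon_0)
  next
    case False
    then obtain k where k: "0 < q k"
      by (auto simp: fun_eq_iff)
    have split: "mon q = X k * mon (q(k := q k - 1))" if "0 < q k" for q k
    proof -
      have "mon q = X k ^ q k * (\<Prod>j\<in>UNIV - {k}. X j ^ q j)" for q
        by (simp add: mon_def prod.remove[of UNIV k])
      from this[of q] this[of "q(k := q k - 1)"] show ?thesis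
        using that by (simp add: power_eq_if mult.assoc)
    qed
    define q' where "q' = q(k := q k - 1)"
    show ?thesis
    proof (cases "q' = (\<lambda>_. 0)")
      case True
      then have "q = (\<lambda>j. if j = k then 1 else 0)"
        using k by (auto simp: q'_def fun_eq_iff split: if_splits)
      moreover from this have "k \<noteq> j"
        using that p_j by auto
      ultimately show ?thesis
        using t by (auto simp: mon_unit lookup_X trees_def)
    next
      case False
      then obtain k' where "0 < q' k'"
        by (auto simp: fun_eq_iff)
      then have "lookup (fps_nth (mon q') m) 0 = 0" for m
        by (subst split) (auto simp: fps_mult_nth lookup_sum lookup_zero_mult lookup_X_0)
      then show ?thesis
        unfolding split[of q k, OF k] q'_def[symmetric]
        by (simp add: fps_mult_nth lookup_sum lookup_single_mset_mult lookup_X_0)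
    qed
  qed
  have "a (Node i {#t#}) = lookup (fps_nth (X i) (Suc n)) {#Node i {#t#}#}"
    using t by (simp add: tree_coeff_def trees_def)
  also have "\<dots> = (\<Sum>q | sum q UNIV \<le> n. lookup (scale (F i q) (fps_nth (mon q) n)) {#t#})"
    by (simp add: X_Suc lookup_graft Y_nth[OF order_refl] lookup_sum)
  also have "\<dots> = (\<Sum>q | sum q UNIV \<le> n. if q = p then F i p * a t else 0)"
    using t by (intro sum.cong) (auto simp: other p_j mon_unit lookup_X)
  also have "\<dots> = F i p * a t"
    using p step.hyps by (simp add: finite_sum_le)
  finally have "a (Node i {#t#}) \<noteq> 0"
    using p t by simp
  moreover have "Node i {#t#} \<in> trees i (Suc n)"
    using t by (simp add: trees_def)
  ultimately show ?case
    by blast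
qed

end

section \<open>The pre-Lie algebra\<close>

context hopf_sdse
begin

text \<open>Take for \<open>s\<close> the one-vertex tree, whose coefficient is 1, in
  \<open>lookup_branch_deriv_X\<close>. A tree with nonzero coefficient makes the constant unique,
  so the definite description in \<open>sdse_lambda\<close> denotes it.\<close>

lemma lambda:
  assumes "1 \<le> k" "r \<in> trees i k"
  shows "lookup (branch_deriv (Node j {#}) (fps_nth (X i) (Suc k))) {#r#} = sdse_lambda X k i j * a r"
proof -
  let ?L = "\<lambda>r. lookup (branch_deriv (Node j {#}) (fps_nth (X i) (Suc k))) {#r#}"
  have "Node j {#} \<in> trees j 1"
    by (simp add: trees_def)
  then obtain c where c: "\<forall>r\<in>trees i k. ?L r = c * a r"
    using lookup_branch_deriv_X[of j 1 i k i "Suc k"] a_dot[of j] by (metis mult.right_neutral)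
  obtain t where t: "t \<in> trees i k" "a t \<noteq> 0"
    using ex_nonzero_tree[OF assms(1)] by blast
  have "sdse_lambda X k i j = c"
    unfolding sdse_lambda_def sum_n_leaf
  proof (rule the_equality)
    fix d assume "\<forall>r\<in>trees i k. ?L r = d * a r"
    with c t have "d * a t = c * a t"
      by metis
    then show "d = c"
      using t by simp
  qed (rule c)
  then show ?thesis
    using c assms by simp
qed

section \<open>Primitive forms are determined on the components of the solution\<close>

lemma linear_form_H:
  assumes "f \<in> graded_dual H"
  shows "x \<in> H \<Longrightarrow> y \<in> H \<Longrightarrow> f (x + y) = f x + f y" "x \<in> H \<Longrightarrow> f (scale c x) = c * f x"
  using assms by (auto simp: graded_dual_def)

lemma subspace_g_S: "form.subspace (g_S X)"
  unfolding form.subspace_def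
proof (intro conjI ballI allI)
  show "0 \<in> g_S X"
    by (auto simp: g_S_def prim_dual_def graded_dual_def)
  fix f g c assume f: "f \<in> g_S X" and g: "g \<in> g_S X"
  obtain N where N: "\<forall>n\<ge>N. \<forall>x\<in>H \<inter> homog n. f x = 0"
    using f by (auto simp: g_S_def prim_dual_def graded_dual_def)
  moreover obtain M where "\<forall>n\<ge>M. \<forall>x\<in>H \<inter> homog n. g x = 0"
    using g by (auto simp: g_S_def prim_dual_def graded_dual_def)
  ultimately have "\<forall>n\<ge>max N M. \<forall>x\<in>H \<inter> homog n. (f + g) x = 0"
    by auto
  then have "\<exists>N. \<forall>n\<ge>N. \<forall>x\<in>H \<inter> homog n. (f + g) x = 0"
    by blast
  then show "f + g \<in> g_S X"
    using f g by (simp add: g_S_def prim_dual_def graded_dual_def algebra_simps)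
next
  fix f c assume f: "f \<in> g_S X"
  then obtain N where "\<forall>n\<ge>N. \<forall>x\<in>H \<inter> homog n. f x = 0"
    by (auto simp: g_S_def prim_dual_def graded_dual_def)
  then have "\<exists>N. \<forall>n\<ge>N. \<forall>x\<in>H \<inter> homog n. fscale c f x = 0"
    by (auto simp: fscale_def)
  then show "fscale c f \<in> g_S X"
    using f by (simp add: g_S_def prim_dual_def graded_dual_def fscale_def algebra_simps)
qed

text \<open>The kernel of \<open>f\<close> in \<open>H\<close> is shown to be a subalgebra; as it
  contains the generators, it is all of \<open>H\<close>.\<close>

lemma g_S_eq_0:
  assumes f: "f \<in> g_S X" and zero: "\<And>j l. 1 \<le> l \<Longrightarrow> f (fps_nth (X j) l) = 0"
  shows "f = 0"
proof -
  define A where "A = {x \<in> H. f x = 0}"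
  have fd: "f \<in> graded_dual H" and f_1: "f 1 = 0"
    and f_mult: "\<And>x y. x \<in> H \<Longrightarrow> y \<in> H \<Longrightarrow> counit x = 0 \<Longrightarrow> counit y = 0 \<Longrightarrow> f (x * y) = 0"
    using f by (auto simp: g_S_def prim_dual_def)
  note lin = linear_form_H[OF fd]
  have f_0: "f 0 = 0"
    using lin(2)[OF one_in_H, of 0] by simp
  have "subalgebra A"
    unfolding subalgebra_def free.subspace_def
  proof (intro conjI ballI allI)
    show "0 \<in> A" "1 \<in> A"
      using f_0 f_1 one_in_H free.subspace_0[OF subspace_H] by (auto simp: A_def)
    fix x y assume "x \<in> A" "y \<in> A"
    then have x: "x \<in> H" "f x = 0" and y: "y \<in> H" "f y = 0"
      by (auto simp: A_def)
    then show "x + y \<in> A"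
      by (auto simp: A_def lin add_in_H)
    \<comment> \<open>Subtracting the constants moves both factors into the augmentation ideal,
      where \<open>f\<close> kills the product; the correction terms are multiples of
      \<open>x\<close>, \<open>y\<close> and \<open>1\<close>.\<close>
    define x' y' where "x' = x + scale (- counit x) 1" and "y' = y + scale (- counit y) 1"
    have x': "x' \<in> H" "counit x' = 0" and y': "y' \<in> H" "counit y' = 0"
      using x y unfolding x'_def y'_def counit_def
      by (auto simp: lookup_add lookup_one simp del: free.scale_minus_left
          intro!: add_in_H scale_in_H one_in_H)
    have "x * y = x' * y' + (scale (counit x) y + (scale (counit y) x + scale (- (counit x * counit y)) 1))"
      unfolding x'_def y'_def
      by (simp add: algebra_simps scale_mult_left scale_mult_right free.scale_right_distrib
          free.scale_minus_left free.scale_minus_right free.scale_scale)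
    moreover have "f (x' * y' + (scale (counit x) y + (scale (counit y) x + scale (- (counit x * counit y)) 1))) = 0"
      using x y x' y'
      by (simp add: lin f_mult f_1 add_in_H scale_in_H mult_in_H one_in_H
          del: free.scale_minus_left)
    ultimately show "x * y \<in> A"
      using mult_in_H[OF x(1) y(1)] unfolding A_def by simp
  next
    fix c x assume "x \<in> A"
    then show "scale c x \<in> A"
      by (auto simp: A_def lin scale_in_H)
  qed
  moreover have "fps_nth (X i) n \<in> A" for i n
    using zero[of n i] f_0 X_in_H[of i n] by (cases n) (auto simp: A_def)
  ultimately have "H \<subseteq> A"
    by (rule H_subset)
  moreover have "f x = 0" if "x \<notin> H" for x
    using fd that by (auto simp: graded_dual_def)
  ultimately show ?thesis
    by (auto simp: A_def fun_eq_iff)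
qed

lemma g_S_eqI:
  assumes "f \<in> g_S X" "g \<in> g_S X" "\<And>j l. 1 \<le> l \<Longrightarrow> f (fps_nth (X j) l) = g (fps_nth (X j) l)"
  shows "f = g"
  using g_S_eq_0[of "f - g"] assms form.subspace_diff[OF subspace_g_S] by auto

section \<open>An explicit model of the dual family\<close>

definition tau :: "'i \<Rightarrow> nat \<Rightarrow> 'i rtree" where
  "tau i n = (SOME t. t \<in> trees i n \<and> a t \<noteq> 0)"

lemma tau: "1 \<le> n \<Longrightarrow> tau i n \<in> trees i n" "1 \<le> n \<Longrightarrow> a (tau i n) \<noteq> 0"
  using someI_ex[of "\<lambda>t. t \<in> trees i n \<and> a t \<noteq> 0"] ex_nonzero_tree[of n i]
  by (auto simp: tau_def)

text \<open>Candidate for the form dual to \<open>X i\<close> in degree \<open>k\<close>. By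
  \<open>lookup_H_trees\<close> the quotient does not depend on which tree with nonzero coefficient
  is chosen, for \<open>k \<ge> 1\<close>.\<close>

definition tree_form :: "'i \<Rightarrow> nat \<Rightarrow> ('i, 'k) ck \<Rightarrow> 'k" where
  "tree_form i k x = (if x \<in> H then lookup x {#tau i k#} / a (tau i k) else 0)"

lemma tree_form_g_S: "tree_form i k \<in> g_S X"
proof -
  have "lookup x {#tau i k#} = 0" if "x \<in> homog n" "Suc (nverts (tau i k)) \<le> n" for x :: "('i, 'k) ck" and n
    using that by (force simp: homog_def in_keys_iff)
  then have "\<exists>N. \<forall>n\<ge>N. \<forall>x\<in>H \<inter> homog n. tree_form i k x = 0"
    by (intro exI[of _ "Suc (nverts (tau i k))"]) (auto simp: tree_form_def)
  then show ?thesis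
    unfolding g_S_def prim_dual_def graded_dual_def
    by (simp add: tree_form_def add_in_H scale_in_H mult_in_H one_in_H lookup_add add_divide_distrib
        lookup_one counit_def lookup_single_mset_mult)
qed

lemma tree_form_X: "1 \<le> k \<Longrightarrow> tree_form i k (fps_nth (X j) l) = (if i = j \<and> k = l then 1 else 0)"
  using tau[of k i] by (auto simp: tree_form_def X_in_H lookup_X trees_def)

lemma dual_elt_eq_tree_form:
  assumes "1 \<le> k"
  shows "dual_elt X i k = tree_form i k"
  unfolding dual_elt_def
proof (rule the_equality)
  fix f assume "f \<in> g_S X \<and> (\<forall>j. \<forall>l\<ge>1. f (fps_nth (X j) l) = (if i = j \<and> k = l then 1 else 0))"
  then show "f = tree_form i k"
    using assms by (intro g_S_eqI) (auto simp: tree_form_g_S tree_form_X)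
qed (use assms in \<open>auto simp: tree_form_g_S tree_form_X\<close>)

lemma dual_elt_g_S: "1 \<le> k \<Longrightarrow> dual_elt X i k \<in> g_S X"
  and dual_elt_X: "1 \<le> k \<Longrightarrow> dual_elt X i k (fps_nth (X j) l) = (if i = j \<and> k = l then 1 else 0)"
  by (simp_all add: dual_elt_eq_tree_form tree_form_g_S tree_form_X)

section \<open>The dual family is a basis\<close>

lemma inj_dual_elt: "inj_on (\<lambda>(i, k). dual_elt X i k) (UNIV \<times> {1..})"
proof (rule inj_onI, clarify)
  fix i j :: 'i and k l :: nat assume k: "1 \<le> k" and l: "1 \<le> l" and eq: "dual_elt X i k = dual_elt X j l"
  have "dual_elt X j l (fps_nth (X i) k) = 1"
    unfolding eq[symmetric] dual_elt_X[OF k] by simp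
  then show "i = j \<and> k = l"
    unfolding dual_elt_X[OF l] by (auto split: if_splits)
qed

lemma sum_fun_apply: "(\<Sum>v\<in>A. f v) x = (\<Sum>v\<in>A. f v x)"
  by (induction A rule: infinite_finite_induct) auto

lemma independent_dual_elt: "form.independent ((\<lambda>(i, k). dual_elt X i k) ` (UNIV \<times> {1..}))"
  unfolding form.independent_explicit_module
proof (intro allI impI)
  let ?D = "(\<lambda>(i, k). dual_elt X i k) ` (UNIV \<times> {1..})"
  fix T u v
  assume T: "finite T" "T \<subseteq> ?D" and zero: "(\<Sum>w\<in>T. fscale (u w) w) = 0" and v: "v \<in> T"
  then obtain i k where k: "1 \<le> k" and v_eq: "v = dual_elt X i k"
    by auto
  have "(\<Sum>w\<in>T. fscale (u w) w) (fps_nth (X i) k) = (\<Sum>w\<in>T. if w = v then u v else 0)"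
    unfolding sum_fun_apply
  proof (rule sum.cong)
    fix w assume "w \<in> T"
    then obtain j l where "1 \<le> l" "w = dual_elt X j l"
      using T by auto
    then show "fscale (u w) w (fps_nth (X i) k) = (if w = v then u v else 0)"
      using k dual_elt_X[of l j i k] dual_elt_X[of k i i k] by (auto simp: v_eq fscale_def)
  qed simp
  then show "u v = 0"
    using T v zero by simp
qed

text \<open>A form in the graded dual vanishes in all high degrees, so only finitely many of its
  values on the \<open>X i\<close> components are nonzero; the combination \<open>g\<close> with
  these values as coefficients agrees with it on all generators.\<close>

lemma span_dual_elt: "form.span ((\<lambda>(i, k). dual_elt X i k) ` (UNIV \<times> {1..})) = g_S X"
proof (intro equalityI subsetI)
  have "(\<lambda>(i, k). dual_elt X i k) ` (UNIV \<times> {1..}) \<subseteq> g_S X"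
    using dual_elt_g_S by auto
  then show "f \<in> g_S X" if "f \<in> form.span ((\<lambda>(i, k). dual_elt X i k) ` (UNIV \<times> {1..}))" for f
    using form.span_minimal[OF _ subspace_g_S] that by blast
next
  fix f assume f: "f \<in> g_S X"
  then obtain N where "\<forall>n\<ge>N. \<forall>x\<in>H \<inter> homog n. f x = 0"
    by (auto simp: g_S_def prim_dual_def graded_dual_def)
  moreover have "fps_nth (X j) n \<in> homog n" for j n
    using solution by (auto simp: sdse_solution_def completion_def)
  ultimately have N: "f (fps_nth (X j) n) = 0" if "N \<le> n" for j n
    using that X_in_H by blast
  define g where "g = (\<Sum>(i, k)\<in>UNIV \<times> {1..N}. fscale (f (fps_nth (X i) k)) (dual_elt X i k))"
  have in_span: "g \<in> form.span ((\<lambda>(i, k). dual_elt X i k) ` (UNIV \<times> {1..}))"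
    unfolding g_def
  proof (intro form.span_sum, clarify)
    fix i :: 'i and k assume "k \<in> {1..N}"
    then have "dual_elt X i k \<in> (\<lambda>(i, k). dual_elt X i k) ` (UNIV \<times> {1..})"
      by (intro image_eqI[of _ _ "(i, k)"]) auto
    then show "fscale (f (fps_nth (X i) k)) (dual_elt X i k)
        \<in> form.span ((\<lambda>(i, k). dual_elt X i k) ` (UNIV \<times> {1..}))"
      by (intro form.span_scale form.span_base)
  qed
  have "g (fps_nth (X j) l) = f (fps_nth (X j) l)" if "1 \<le> l" for j l
  proof -
    have "g (fps_nth (X j) l) = (\<Sum>p\<in>UNIV \<times> {1..N}. if p = (j, l) then f (fps_nth (X j) l) else 0)"
      unfolding g_def sum_fun_apply by (rule sum.cong) (auto simp: fscale_def dual_elt_X split: if_splits)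
    then show ?thesis
      using that N[of l j] by (auto simp: not_le)
  qed
  moreover have "g \<in> g_S X"
    unfolding g_def
    by (intro form.subspace_sum[OF subspace_g_S])
      (auto intro!: form.subspace_scale[OF subspace_g_S] dual_elt_g_S)
  ultimately have "f = g"
    using f by (intro g_S_eqI) auto
  then show "f \<in> form.span ((\<lambda>(i, k). dual_elt X i k) ` (UNIV \<times> {1..}))"
    using in_span by simp
qed

text \<open>The projection fixes the generators and maps \<open>x * y\<close> to a combination of
  the projections of \<open>x\<close> and \<open>y\<close>, so the preimage of \<open>H\<close> is a
  subalgebra. This keeps the projected coproduct inside the domain of
  \<open>tensor_form\<close>.\<close>

lemma tree_proj_in_H:
  assumes "x \<in> H"
  shows "tree_proj x \<in> H"
proof -
  interpret tree_proj: module_hom scale scale "tree_proj :: ('i, 'k) ck \<Rightarrow> _"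
    using tree_proj_linear by (simp only: Vector_Spaces.linear_iff_module_hom)
  define A where "A = {x :: ('i, 'k) ck. tree_proj x \<in> H}"
  have one: "tree_proj 1 = (0 :: ('i, 'k) ck)"
    by (rule poly_mapping_eqI) (auto simp: lookup_tree_proj lookup_one when_def)
  have mult: "tree_proj (x * y) = scale (lookup x 0) (tree_proj y) + scale (lookup y 0) (tree_proj x)"
    for x y :: "('i, 'k) ck"
  proof (rule poly_mapping_eqI)
    fix f
    show "lookup (tree_proj (x * y)) f =
        lookup (scale (lookup x 0) (tree_proj y) + scale (lookup y 0) (tree_proj x)) f"
    proof (cases "size f = 1")
      case True
      then obtain t where "f = {#t#}"
        using size_1_singleton_mset by blast
      then show ?thesis
        by (simp add: lookup_tree_proj lookup_add lookup_single_mset_mult)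
    qed (simp add: lookup_tree_proj lookup_add)
  qed
  have X: "tree_proj (fps_nth (X i) n) = fps_nth (X i) n" for i n
  proof (rule poly_mapping_eqI)
    fix f show "lookup (tree_proj (fps_nth (X i) n)) f = lookup (fps_nth (X i) n) f"
      using lookup_X_nonzero[of i n f] by (cases "lookup (fps_nth (X i) n) f = 0") (auto simp: lookup_tree_proj)
  qed
  have "subalgebra A"
    unfolding subalgebra_def free.subspace_def A_def
    using free.subspace_0[OF subspace_H]
    by (auto simp: one mult tree_proj.add tree_proj.scale tree_proj.zero intro: add_in_H scale_in_H)
  then have "H \<subseteq> A"
    by (rule H_subset) (simp add: A_def X X_in_H)
  then show ?thesis
    using assms by (auto simp: A_def)
qed

lemma tensor_map_tree_proj_tensor_set:
  assumes "z \<in> tensor_set H"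
  shows "tensor_map tree_proj tree_proj z \<in> tensor_set H"
proof -
  interpret tm: module_hom scale scale "tensor_map tree_proj tree_proj :: ('i, 'k) ck2 \<Rightarrow> _"
    using tensor_map_linear by (simp only: Vector_Spaces.linear_iff_module_hom)
  define A where "A = {z. tensor_map tree_proj tree_proj z \<in> tensor_set H}"
  have "free.subspace A"
    unfolding free.subspace_def A_def tensor_set_def
    by (auto simp: tm.add tm.scale tm.zero intro: free.span_add free.span_scale free.span_zero)
  moreover have "{tensor u v | u v. u \<in> H \<and> v \<in> H} \<subseteq> A"
  proof clarify
    fix u v assume "u \<in> H" "v \<in> H"
    then have "tensor (tree_proj u) (tree_proj v) \<in> tensor_set H"
      unfolding tensor_set_def by (blast intro: free.span_base tree_proj_in_H)
    then show "tensor u v \<in> A"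
      by (simp add: A_def tensor_map_tensor tree_proj_linear)
  qed
  ultimately have "tensor_set H \<subseteq> A"
    unfolding tensor_set_def by (intro free.span_minimal)
  then show ?thesis
    using assms by (auto simp: A_def)
qed

lemma tensor_set_sum_list:
  assumes "z \<in> tensor_set H"
  shows "\<exists>xs. (\<forall>(u, v)\<in>set xs. u \<in> H \<and> v \<in> H) \<and> z = (\<Sum>(u, v)\<leftarrow>xs. tensor u v)"
proof -
  define A where "A = {z. \<exists>xs. (\<forall>(u, v)\<in>set xs. u \<in> H \<and> v \<in> H) \<and> z = (\<Sum>(u, v)\<leftarrow>xs. tensor u v)}"
  have "free.subspace A"
    unfolding free.subspace_def
  proof (intro conjI ballI allI)
    show "0 \<in> A"
      by (auto simp: A_def intro: exI[of _ "[]"])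
    fix x y assume "x \<in> A" "y \<in> A"
    then obtain xs ys where
      "\<forall>(u, v)\<in>set xs. u \<in> H \<and> v \<in> H" "x = (\<Sum>(u, v)\<leftarrow>xs. tensor u v)"
      "\<forall>(u, v)\<in>set ys. u \<in> H \<and> v \<in> H" "y = (\<Sum>(u, v)\<leftarrow>ys. tensor u v)"
      by (auto simp: A_def)
    then show "x + y \<in> A"
      unfolding A_def by (intro CollectI exI[of _ "xs @ ys"]) auto
  next
    fix x and c :: 'k assume "x \<in> A"
    then obtain xs where xs: "\<forall>(u, v)\<in>set xs. u \<in> H \<and> v \<in> H" "x = (\<Sum>(u, v)\<leftarrow>xs. tensor u v)"
      by (auto simp: A_def)
    have "scale c (\<Sum>(u, v)\<leftarrow>xs. tensor u v) = (\<Sum>(u, v)\<leftarrow>map (\<lambda>(u, v). (scale c u, v)) xs. tensor u v)"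
      for xs :: "(('i, 'k) ck \<times> ('i, 'k) ck) list"
      by (induction xs) (auto simp: free.scale_right_distrib tensor_scale_left)
    then show "scale c x \<in> A"
      unfolding A_def using xs
      by (intro CollectI exI[of _ "map (\<lambda>(u, v). (scale c u, v)) xs"]) (auto intro: scale_in_H)
  qed
  moreover have "{tensor u v | u v. u \<in> H \<and> v \<in> H} \<subseteq> A"
  proof clarify
    fix u v assume "u \<in> H" "v \<in> H"
    then show "tensor u v \<in> A"
      unfolding A_def by (intro CollectI exI[of _ "[(u, v)]"]) auto
  qed
  ultimately have "tensor_set H \<subseteq> A"
    unfolding tensor_set_def by (intro free.span_minimal)
  then show ?thesis
    using assms by (auto simp: A_def)
qed

text \<open>On every list of pure tensors summing to \<open>z\<close> the value is the same
  coefficient of \<open>z\<close>, up to normalisation; hence \<open>tensor_form\<close> is well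
  defined here.\<close>

lemma tensor_form_tree_form:
  assumes "z \<in> tensor_set H"
  shows "tensor_form H (tree_form j l) (tree_form i k) z =
     lookup z ({#tau j l#}, {#tau i k#}) / (a (tau j l) * a (tau i k))"
proof -
  have form_value: "(\<Sum>(u, v)\<leftarrow>xs. tree_form j l u * tree_form i k v) =
      lookup (\<Sum>(u, v)\<leftarrow>xs. tensor u v) ({#tau j l#}, {#tau i k#}) / (a (tau j l) * a (tau i k))"
    if "\<forall>(u, v)\<in>set xs. u \<in> H \<and> v \<in> H" for xs
    using that by (induction xs) (auto simp: tree_form_def lookup_add add_divide_distrib)
  show ?thesis
    unfolding tensor_form_def
  proof (rule the_equality)
    show "\<exists>xs. (\<forall>(u, v)\<in>set xs. u \<in> H \<and> v \<in> H) \<and> z = (\<Sum>(u, v)\<leftarrow>xs. tensor u v) \<and>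
        lookup z ({#tau j l#}, {#tau i k#}) / (a (tau j l) * a (tau i k))
          = (\<Sum>(u, v)\<leftarrow>xs. tree_form j l u * tree_form i k v)"
      using tensor_set_sum_list[OF assms] form_value by metis
  qed (use form_value in metis)
qed

text \<open>In the matching case \<open>branch_deriv_X\<close> replaces the branch by a single leaf
  and \<open>lambda\<close> evaluates the result. Otherwise the degrees disagree or the root
  decorations do, since a cut along an edge keeps the root.\<close>

lemma lookup_branch_deriv_tau:
  assumes "1 \<le> k" "1 \<le> l" "1 \<le> n"
  shows "lookup (branch_deriv (tau j l) (fps_nth (X m) n)) {#tau i k#} =
     (if m = i \<and> n = k + l then sdse_lambda X k i j else 0) * (a (tau j l) * a (tau i k))"
proof (cases "m = i \<and> n = k + l")
  case True
  have "nverts (tau j l) = l" "root_deco (tau j l) = j"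
    using tau(1)[OF assms(2), of j] by (auto simp: trees_def)
  with branch_deriv_X[of "tau j l" i k] lambda[OF assms(1) tau(1)[OF assms(1), of i], of j] True
  show ?thesis
    by simp
next
  case False
  have "lookup (branch_deriv (tau j l) (fps_nth (X m) n)) {#tau i k#} =
      (\<Sum>t\<in>trees m n. a t * lookup (cut_branch (tau j l) t) {#tau i k#})"
    by (subst X_expand)
      (simp add: branch_deriv_sum branch_deriv_scale lookup_branch_deriv_tree lookup_sum)
  also have "\<dots> = 0"
  proof (rule sum.neutral, rule ballI)
    fix t assume t: "t \<in> trees m n"
    have "m = i \<and> n = k + l" if nz: "lookup (cut_branch (tau j l) t :: ('i, 'k) ck) {#tau i k#} \<noteq> 0"
    proof -
      have "n = k + l"
        using degree_cut_branch[OF nz] t tau(1)[OF assms(1), of i] tau(1)[OF assms(2), of j]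
        by (auto simp: trees_def)
      moreover have "m = i"
        using nz t tau(1)[OF assms(1), of i]
        by (cases t; cases "tau i k") (auto simp: trees_def lookup_graft split: if_splits)
      ultimately show ?thesis
        by simp
    qed
    with False show "a t * lookup (cut_branch (tau j l) t) {#tau i k#} = 0"
      by auto
  qed
  finally show ?thesis
    unfolding if_not_P[OF False] by simp
qed

lemma prelie_dual_elt:
  assumes k: "1 \<le> k" and l: "1 \<le> l"
  shows "prelie X (dual_elt X j l) (dual_elt X i k) =
     fscale (sdse_lambda X k i j) (dual_elt X i (k + l))"
proof -
  let ?V = "free.span {fps_nth (X i) n | i n. n \<ge> 1}"
  let ?h = "fscale (sdse_lambda X k i j) (tree_form i (k + l))"
  let ?T = "\<lambda>x. tensor_form H (tree_form j l) (tree_form i k) (tensor_map tree_proj tree_proj (coprod x))"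
  let ?c = "a (tau j l) * a (tau i k)"
  interpret coprod: module_hom scale scale "coprod :: ('i, 'k) ck \<Rightarrow> _"
    using coprod_linear by (simp only: Vector_Spaces.linear_iff_module_hom)
  have kl: "1 \<le> k + l" and c: "?c \<noteq> 0"
    using k l by (auto simp: tau)
  have h: "?h \<in> g_S X"
    by (intro form.subspace_scale[OF subspace_g_S] tree_form_g_S)
  have "coprod x \<in> tensor_set H" if "x \<in> H" for x
    using hopf that by (auto simp: hopf_subalgebra_def)
  then have T: "?T x = lookup (coprod x) ({#tau j l#}, {#tau i k#}) / ?c" if "x \<in> H" for x
    using that by (simp add: tensor_form_tree_form tensor_map_tree_proj_tensor_set lookup_tensor_map_tree_proj)
  \<comment> \<open>Both sides are linear in \<open>x\<close>, so the comparison reduces to the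
    generators, where \<open>lookup_branch_deriv_tau\<close> applies.\<close>
  have "?V \<subseteq> {x \<in> H. ?h x = lookup (coprod x) ({#tau j l#}, {#tau i k#}) / ?c}" (is "_ \<subseteq> ?A")
  proof (rule free.span_minimal)
    show "{fps_nth (X i) n | i n. n \<ge> 1} \<subseteq> ?A"
      using c by (auto simp: X_in_H lookup_coprod_X lookup_branch_deriv_tau[OF k l] fscale_def tree_form_X[OF kl])
    show "free.subspace ?A"
      unfolding free.subspace_def
    proof (intro conjI ballI allI)
      fix x y c assume x: "x \<in> ?A" and y: "y \<in> ?A"
      note lin = linear_form_H[of ?h, OF h[unfolded g_S_def prim_dual_def, THEN CollectD, THEN conjunct1]]
      show "x + y \<in> ?A" "scale c x \<in> ?A"
        using x y
        by (simp_all add: lin coprod.add coprod.scale lookup_add add_in_H scale_in_H add_divide_distrib)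
    qed (simp add: fscale_def tree_form_def coprod.zero free.subspace_0[OF subspace_H])
  qed
  then have hT: "\<forall>x\<in>?V. ?h x = ?T x"
    using T by auto
  have "prelie X (tree_form j l) (tree_form i k) = ?h"
    unfolding prelie_def
  proof (rule the_equality)
    show "?h \<in> g_S X \<and> (\<forall>x\<in>?V. ?h x = ?T x)"
      using h hT by blast
    fix g assume g: "g \<in> g_S X \<and> (\<forall>x\<in>?V. g x = ?T x)"
    have "fps_nth (X m) n \<in> ?V" if "1 \<le> n" for m n
      using that by (intro free.span_base) auto
    with g h hT show "g = ?h"
      by (intro g_S_eqI) auto
  qed
  then show ?thesis
    using k l by (simp add: dual_elt_eq_tree_form)
qed

end

theorem proposition21:
  fixes F :: "'i::finite \<Rightarrow> ('i, 'k::field_char_0) mps"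
    and X :: "'i \<Rightarrow> ('i, 'k) ck fps"
  assumes "\<forall>i. nonconstant (F i)"
    and "\<forall>i. F i (\<lambda>_. 0) = 1"
    and "sdse_solution F X"
    and "hopf_subalgebra (H_S X)"
  shows "(\<forall>i. \<forall>k\<ge>1. \<forall>j. \<forall>l\<ge>1.
            dual_elt X i k (fps_nth (X j) l) = (if i = j \<and> k = l then 1 else 0))
    \<and> inj_on (\<lambda>(i, k). dual_elt X i k) (UNIV \<times> {1..})
    \<and> \<not> module.dependent fscale ((\<lambda>(i, k). dual_elt X i k) ` (UNIV \<times> {1..}))
    \<and> module.span fscale ((\<lambda>(i, k). dual_elt X i k) ` (UNIV \<times> {1..})) = g_S X
    \<and> (\<forall>i j. \<forall>k\<ge>1. \<forall>l\<ge>1.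
          prelie X (dual_elt X j l) (dual_elt X i k)
            = fscale (sdse_lambda X k i j) (dual_elt X i (k + l)))"
proof -
  interpret hopf_sdse F X
    using assms by unfold_locales auto
  show ?thesis
    using dual_elt_X inj_dual_elt independent_dual_elt span_dual_elt prelie_dual_elt by blast
qed

end
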